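(* Fix an integer $k\ge 4$, let $\Delta=\sqrt{k}\,(20k)^{2k}$, and let $d$ be a real number with \[ d\ge \max\big(2\sqrt{5}\sqrt{k\log k}\; n^{1/k},\ (20k)^{4k^2+2k}\big). \] If $G$ is a graph on $n$ vertices whose minimum degree is at least $2d+5k^2$ and whose maximum degree is at most $\Delta d$, then $G$ contains a copy of $C_{2k}$.
   Context: $\log$ denotes the natural logarithm. $C_{2k}$ is the cycle on $2k$ vertices. *)

theory Defs
  imports Complex_Main
begin

definition simple_graph :: "'a set \<Rightarrow> 'a set set \<Rightarrow> bool" where
  "simple_graph V E \<longleftrightarrow> finite V \<and> (\<forall>e\<in>E. e \<subseteq> V \<and> card e = 2)"

definition vdegree :: "'a set set \<Rightarrow> 'a \<Rightarrow> nat" where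
  "vdegree E v = card {e \<in> E. v \<in> e}"

(* min_degree and max_degree are meaningful only for a nonempty finite vertex set. *)
definition min_degree :: "'a set \<Rightarrow> 'a set set \<Rightarrow> nat" where
  "min_degree V E = Min (vdegree E ` V)"

definition max_degree :: "'a set \<Rightarrow> 'a set set \<Rightarrow> nat" where
  "max_degree V E = Max (vdegree E ` V)"

(* The cycle on m vertices has vertex set {..<m}; it is a simple graph for m at least 3. *)
definition cycle_edges :: "nat \<Rightarrow> nat set set" where
  "cycle_edges m = {{i, Suc i mod m} | i. i < m}"

(* (V, E) has a subgraph, not necessarily induced, isomorphic to (W, F). *)
definition contains_copy :: "'a set \<Rightarrow> 'a set set \<Rightarrow> 'b set \<Rightarrow> 'b set set \<Rightarrow> bool" where
  "contains_copy V E W F \<longleftrightarrow>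
     (\<exists>f. inj_on f W \<and> f ` W \<subseteq> V \<and> (\<forall>e\<in>F. f ` e \<in> E))"

end

(*
  Suppose there is no C_2k. A maximum cut gives a bipartite subgraph of minimum degree at least
  m + k^2 with m = ceiling d; let L_0, L_1, ... be its breadth-first levels from some root. In a
  cycle of length at least 2k with a chord, any proper nonempty subset W of one colour class is
  joined to its complement in that class by a path of each even length below 2k. Closing such paths
  through the search tree produces a C_2k, so no such cycle lies between two consecutive levels, nor
  (if its middle vertices all have a neighbour outside it on the level before) in three consecutive
  ones. The first fact bounds the number of edges between consecutive levels. The second bounds the
  number of vertices of L_(i+1) having at least t neighbours in L_i by roughly
  (4k / (t m)) |L_(i+2)|; summed over t < k, this gives m^2 |L_i| <= 20 k ln k |L_(i+2)|.
  Hence |L_k| >= (m / sqrt (20 k ln k))^k >= n, which is absurd.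
*)

theory Submission
  imports Defs
begin

text \<open>The bound on edges between two consecutive levels alone yields growth by about
  \<open>m / k\<close> per level, short of the target by a factor of order
  \<open>sqrt (k / ln k)\<close>. The gain comes from trading backward degree against spacing. A
  path that visits the first of three levels only every \<open>2 * D\<close> steps, and meets
  \<open>c\<close> of the backward neighbours of one vertex, has length about
  \<open>2 * c * D\<close>; so \<open>c * D\<close> near \<open>k\<close> suffices for a long cycle,
  and a backward degree \<open>t\<close> near \<open>2 * c\<close> allows \<open>D\<close> near
  \<open>2 * k / t\<close>. As \<open>D\<close> is also the degree required from the third level to
  the middle one, the factor \<open>4 * k / t\<close> results, whose sum over \<open>t\<close> is
  the source of the logarithm. The obstacle is that a cycle in three levels is useful only if each
  of its middle vertices can step back off the cycle, since ancestral lines must avoid it. This is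
  why backward degree \<open>2 * c\<close> is kept: a path meets fewer than \<open>c\<close> of the
  backward neighbours of a vertex on either side of it.\<close>

section \<open>Paths of prescribed length in a cycle with a chord\<close>

text \<open>A cycle of length at least \<open>2k\<close> with a chord. The cycle is rotated so that the chord starts at its first vertex.\<close>

definition theta :: "('a \<Rightarrow> 'a \<Rightarrow> bool) \<Rightarrow> nat \<Rightarrow> 'a list \<Rightarrow> bool" where
  "theta adj k R \<longleftrightarrow> distinct R \<and> successively adj R \<and> 2 * k \<le> length R \<and> adj (last R) (hd R) \<and>
     (\<exists>j. 2 \<le> j \<and> j + 2 \<le> length R \<and> adj (R ! 0) (R ! j))"

lemma theta_mono:
  assumes "theta adj k R" and "\<And>u v. adj u v \<Longrightarrow> adj' u v"
  shows "theta adj' k R"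
  using assms unfolding theta_def by (blast intro: successively_mono)

definition path_in :: "('a \<Rightarrow> 'a \<Rightarrow> bool) \<Rightarrow> 'a set \<Rightarrow> nat \<Rightarrow> (nat \<Rightarrow> 'a) \<Rightarrow> bool" where
  "path_in adj S l p \<longleftrightarrow> inj_on p {..l} \<and> p ` {..l} \<subseteq> S \<and> (\<forall>i<l. adj (p i) (p (Suc i)))"

lemma path_in_rev:
  assumes "path_in adj S l p" and sym: "\<And>u v. adj u v \<Longrightarrow> adj v u"
  shows "path_in adj S l (\<lambda>i. p (l - i))"
  unfolding path_in_def
proof (intro conjI allI impI)
  have inj: "inj_on p {..l}" and adj: "\<And>i. i < l \<Longrightarrow> adj (p i) (p (Suc i))"
    and sub: "p ` {..l} \<subseteq> S"
    using assms(1) by (auto simp: path_in_def)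
  show "inj_on (\<lambda>i. p (l - i)) {..l}"
  proof (rule inj_onI)
    fix x y assume "x \<in> {..l}" "y \<in> {..l}" "p (l - x) = p (l - y)"
    then show "x = y"
      using inj_onD[OF inj, of "l - x" "l - y"] by auto
  qed
  show "(\<lambda>i. p (l - i)) ` {..l} \<subseteq> S"
    using sub by auto
  show "adj (p (l - i)) (p (l - Suc i))" if "i < l" for i
    using sym[OF adj[of "l - Suc i"]] that by (simp add: Suc_diff_Suc)
qed

section \<open>Periodic two-colourings of the integers\<close>

lemma periodic_multiple:
  fixes \<chi> :: "int \<Rightarrow> bool"
  assumes "\<And>x. \<chi> (x + q) = \<chi> x"
  shows "\<chi> (x + s * q) = \<chi> x"
proof (induction s rule: int_induct[where k = 0])
  case base
  then show ?case by simp
next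
  case (step1 i)
  then show ?case using assms[of "x + i * q"] by (simp add: algebra_simps)
next
  case (step2 i)
  then show ?case using assms[of "x + (i - 1) * q"] by (simp add: algebra_simps)
qed

lemma shift_into_window:
  fixes q a b x :: int
  assumes "q > 0" and "b - a + 1 \<ge> q"
  obtains s where "a \<le> x + s * q" and "x + s * q \<le> b"
proof
  have 1: "0 \<le> (x - a) mod q" "(x - a) mod q < q" using assms(1) by simp_all
  have 2: "x + (- ((x - a) div q)) * q = a + (x - a) mod q"
    using div_mult_mod_eq[of "x - a" q] by linarith
  show "a \<le> x + (- ((x - a) div q)) * q" unfolding 2 using 1 by linarith
  show "x + (- ((x - a) div q)) * q \<le> b" unfolding 2 using 1 assms(2) by linarith
qed

text \<open>A multiple \<open>s * q\<close> moves any \<open>x\<close> into the window, where the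
  symmetry is known; the reflected point \<open>c - x\<close> then moves by \<open>- s * q\<close>,
  which does not change its colour either.\<close>

lemma reflection_window_global:
  fixes \<chi> :: "int \<Rightarrow> bool"
  assumes per: "\<And>x. \<chi> (x + q) = \<chi> x" and "q > 0" and "b - a + 1 \<ge> q"
    and win: "\<And>x. a \<le> x \<Longrightarrow> x \<le> b \<Longrightarrow> \<chi> (c - x) = \<chi> x"
  shows "\<chi> (c - x) = \<chi> x"
proof -
  obtain s where s: "a \<le> x + s * q" "x + s * q \<le> b"
    using shift_into_window[OF assms(2,3)] by blast
  have "\<chi> (c - x) = \<chi> (c - x + (- s) * q)"
    using periodic_multiple[of \<chi> q "c - x" "- s", OF per] by simp
  also have "c - x + (- s) * q = c - (x + s * q)" by simp
  also have "\<chi> \<dots> = \<chi> (x + s * q)" using win[OF s] .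
  also have "\<dots> = \<chi> x" using periodic_multiple[of \<chi> q x s, OF per] by simp
  finally show ?thesis .
qed

lemma translation_window_global:
  fixes \<chi> :: "int \<Rightarrow> bool"
  assumes per: "\<And>x. \<chi> (x + q) = \<chi> x" and "q > 0" and "b - a + 1 \<ge> q"
    and win: "\<And>x. a \<le> x \<Longrightarrow> x \<le> b \<Longrightarrow> \<chi> (x + c) = \<chi> x"
  shows "\<chi> (x + c) = \<chi> x"
proof -
  obtain s where s: "a \<le> x + s * q" "x + s * q \<le> b"
    using shift_into_window[OF assms(2,3)] by blast
  have "\<chi> (x + c) = \<chi> (x + c + s * q)"
    using periodic_multiple[of \<chi> q "x + c" s, OF per] by simp
  also have "x + c + s * q = x + s * q + c" by simp
  also have "\<chi> \<dots> = \<chi> (x + s * q)" using win[OF s] .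
  also have "\<dots> = \<chi> x" using periodic_multiple[of \<chi> q x s, OF per] by simp
  finally show ?thesis .
qed

text \<open>A colouring of the cycle of length \<open>r\<close> with chord from \<open>0\<close> to \<open>j\<close>, lifted to \<open>\<int>\<close>. The last four hypotheses
  are the four kinds of path of length \<open>l\<close> through the chord: \<open>a\<close> steps before the chord and \<open>b\<close> after it.
  The first two kinds make \<open>\<chi>\<close> symmetric about two centres on windows of length \<open>w\<close>; as \<open>\<chi>\<close> has some period
  \<open>q \<le> w\<close>, both symmetries are global, and they compose to the translation by 2.\<close>

lemma chord_colouring_period_two:
  fixes \<chi> :: "int \<Rightarrow> bool" and r l j :: int
  assumes r: "\<And>x. \<chi> (x + r) = \<chi> x" and l: "\<And>x. \<chi> (x + l) = \<chi> x"
    and bnd: "0 < l" "l < r" "2 \<le> j" "j + 2 \<le> r"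
    and dn: "\<And>a b. 0 \<le> a \<Longrightarrow> 0 \<le> b \<Longrightarrow> a + b = l - 1 \<Longrightarrow> b < j \<Longrightarrow> a < r - j \<Longrightarrow> \<chi> (j - b) = \<chi> (- a)"
    and up: "\<And>a b. 0 \<le> a \<Longrightarrow> 0 \<le> b \<Longrightarrow> a + b = l - 1 \<Longrightarrow> a < j \<Longrightarrow> b < r - j \<Longrightarrow> \<chi> (j + b) = \<chi> a"
    and fwd: "\<And>a b. 0 \<le> a \<Longrightarrow> 0 \<le> b \<Longrightarrow> a + b = l - 1 \<Longrightarrow> j + l - 1 < r \<Longrightarrow> \<chi> (j + b) = \<chi> (- a)"
    and bwd: "\<And>a b. 0 \<le> a \<Longrightarrow> 0 \<le> b \<Longrightarrow> a + b = l - 1 \<Longrightarrow> l - 1 < j \<Longrightarrow> \<chi> (j - b) = \<chi> a"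
  shows "\<chi> (x + 2) = \<chi> x"
proof -
  \<comment> \<open>The symmetries below hold on windows of length
    \<open>min l (r - j) - max 0 (l - j)\<close> and \<open>min l j - max 0 (l - r + j)\<close>;
    both equal this minimum.\<close>
  define w where "w = Min {l, j, r - j, r - l}"
  have w: "w \<le> l" "w \<le> j" "w \<le> r - j" "w \<le> r - l" by (auto simp: w_def)
  have w_cases: "w = l \<or> w = j \<or> w = r - j \<or> w = r - l" by (auto simp: w_def min_def)
  have rl: "\<chi> (x + (r - l)) = \<chi> x" for x
    using l[of "x + (r - l)"] r[of x] by (simp add: algebra_simps)
  have "\<exists>q. 0 < q \<and> q \<le> w \<and> (\<forall>x. \<chi> (x + q) = \<chi> x)"
  proof -
    consider "w = l" | "w = r - l" | "w = j" | "w = r - j" using w_cases by blast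
    then show ?thesis
    proof cases
      case 1 then show ?thesis using l bnd by auto
    next
      case 2 then show ?thesis using rl bnd by (intro exI[of _ "r - l"]) auto
    next
      case 3
      \<comment> \<open>Here \<open>j \<le> r - l\<close>, so a path running in one direction
        through the chord never meets itself. Its displacement is \<open>j + l - 1\<close>, that is
        \<open>j - 1\<close> modulo the period \<open>l\<close>.\<close>
      have "\<chi> (x + (j - 1)) = \<chi> x" for x
      proof (rule translation_window_global[where \<chi> = \<chi> and q = l and a = "1 - l" and b = 0, OF l bnd(1)])
        fix x :: int assume "1 - l \<le> x" "x \<le> 0"
        then have "\<chi> (j + (l - 1 + x)) = \<chi> x"
          using fwd[of "- x" "l - 1 + x"] w bnd 3 by auto
        moreover have "\<chi> (j + (l - 1 + x)) = \<chi> (x + (j - 1))"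
          using l[of "x + (j - 1)"] by (simp add: algebra_simps)
        ultimately show "\<chi> (x + (j - 1)) = \<chi> x" by simp
      qed simp
      then show ?thesis using bnd 3 by (intro exI[of _ "j - 1"]) auto
    next
      case 4
      \<comment> \<open>Displacement \<open>j - (l - 1)\<close>, that is \<open>j + 1\<close> modulo
        \<open>l\<close>; negated and shifted by the period \<open>r\<close> it becomes
        \<open>r - j - 1\<close>, which is below \<open>w = r - j\<close>.\<close>
      have "\<chi> (x + (j + 1)) = \<chi> x" for x
      proof (rule translation_window_global[where \<chi> = \<chi> and q = l and a = 0 and b = "l - 1", OF l bnd(1)])
        fix x :: int assume "0 \<le> x" "x \<le> l - 1"
        then have "\<chi> (j - (l - 1 - x)) = \<chi> x"
          using bwd[of x "l - 1 - x"] w bnd 4 by auto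
        moreover have "\<chi> (j - (l - 1 - x)) = \<chi> (x + (j + 1))"
          using l[of "j - (l - 1 - x)"] by (simp add: algebra_simps)
        ultimately show "\<chi> (x + (j + 1)) = \<chi> x" by simp
      qed simp
      then have "\<chi> (x + (r - j - 1)) = \<chi> x" for x
        using r[of x] by (metis (no_types) add.assoc diff_add_cancel diff_diff_eq)
      then show ?thesis using bnd 4 by (intro exI[of _ "r - j - 1"]) auto
    qed
  qed
  then obtain q where q: "0 < q" "q \<le> w" "\<And>x. \<chi> (x + q) = \<chi> x" by blast
  have R1: "\<chi> (j + 1 - x) = \<chi> x" for x
  proof (rule reflection_window_global[where \<chi> = \<chi> and q = q and a = "- min (l - 1) (r - j - 1)" and b = "- max 0 (l - j)", OF q(3) q(1)])
    show "q \<le> - max 0 (l - j) - - min (l - 1) (r - j - 1) + 1"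
      using q(2) w by (auto simp: min_def max_def)
  next
    fix x :: int assume "- min (l - 1) (r - j - 1) \<le> x" "x \<le> - max 0 (l - j)"
    then have "0 \<le> - x" "0 \<le> l - 1 + x" "l - 1 + x < j" "- x < r - j" by auto
    then have "\<chi> (j - (l - 1 + x)) = \<chi> x" using dn[of "- x" "l - 1 + x"] by simp
    moreover have "\<chi> (j - (l - 1 + x)) = \<chi> (j + 1 - x)"
      using l[of "j - (l - 1 + x)"] by (simp add: algebra_simps)
    ultimately show "\<chi> (j + 1 - x) = \<chi> x" by simp
  qed
  have R2: "\<chi> (j - 1 - x) = \<chi> x" for x
  proof (rule reflection_window_global[where \<chi> = \<chi> and q = q and a = "max 0 (l - r + j)" and b = "min (l - 1) (j - 1)", OF q(3) q(1)])
    show "q \<le> min (l - 1) (j - 1) - max 0 (l - r + j) + 1"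
      using q(2) w by (auto simp: min_def max_def)
  next
    fix x :: int assume "max 0 (l - r + j) \<le> x" "x \<le> min (l - 1) (j - 1)"
    then have "0 \<le> x" "0 \<le> l - 1 - x" "x < j" "l - 1 - x < r - j" by auto
    then have "\<chi> (j + (l - 1 - x)) = \<chi> x" using up[of x "l - 1 - x"] by simp
    moreover have "\<chi> (j + (l - 1 - x)) = \<chi> (j - 1 - x)"
      using l[of "j - 1 - x"] by (simp add: algebra_simps)
    ultimately show "\<chi> (j - 1 - x) = \<chi> x" by simp
  qed
  show ?thesis
    using R1[of "x + 2"] R2[of x] by (simp add: algebra_simps)
qed

lemma mod_eq_imp_eq:
  fixes x y r :: int
  assumes "x mod r = y mod r" and "c \<le> x" "x < c + r" and "c \<le> y" "y < c + r"
  shows "x = y"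
proof -
  have "r dvd x - y" using assms(1) by (simp add: mod_eq_dvd_iff)
  moreover have "\<bar>x - y\<bar> < \<bar>r\<bar>" using assms(2-5) by auto
  ultimately show ?thesis using dvd_imp_le_int[of "x - y" r] by fastforce
qed

text \<open>If no such path existed, every path of length \<open>l\<close> would have both or
  neither of its ends in \<open>W\<close>. Going round the cycle, membership in \<open>W\<close>
  would have period \<open>l\<close>, and the paths through the chord would then force period 2. So
  \<open>W\<close> would contain all or none of the colour class on the cycle, against
  \<open>w1\<close> and \<open>w2\<close>.\<close>

lemma theta_path_between:
  assumes th: "theta adj k R" and sym: "\<And>u v. adj u v \<Longrightarrow> adj v u"
    and bip: "\<And>u v. u \<in> set R \<Longrightarrow> v \<in> set R \<Longrightarrow> adj u v \<Longrightarrow> u \<in> X \<longleftrightarrow> v \<notin> X"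
    and W: "W \<subseteq> X" and w1: "w1 \<in> W" "w1 \<in> set R" and w2: "w2 \<in> X" "w2 \<in> set R" "w2 \<notin> W"
    and l: "even l" "0 < l" "l + 2 \<le> 2 * k"
  shows "\<exists>p. path_in adj (set R) l p \<and> p 0 \<in> W \<and> p l \<in> X \<and> p l \<notin> W"
proof (rule ccontr)
  assume contra: "\<not> ?thesis"
  define r where "r = int (length R)"
  define pos where "pos x = R ! nat (x mod r)" for x :: int
  define \<chi> where "\<chi> x \<longleftrightarrow> pos x \<in> W" for x
  have dist: "distinct R" and succ: "successively adj R" and lenR: "2 * k \<le> length R"
    and close: "adj (last R) (hd R)"
    using th by (auto simp: theta_def)
  obtain j0 where j0: "2 \<le> j0" "j0 + 2 \<le> length R" "adj (R ! 0) (R ! j0)"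
    using th by (auto simp: theta_def)
  have ne: "R \<noteq> []" and r0: "r > 0" using j0 by (auto simp: r_def)
  have mod_r: "0 \<le> x mod r" "x mod r < r" for x using r0 by simp_all
  have nat_lt: "nat (x mod r) < length R" for x
    using mod_r[of x] by (auto simp: r_def nat_less_iff)
  have pos_in: "pos x \<in> set R" for x using nat_lt by (simp add: pos_def)
  have pos_nat: "pos (int i) = R ! i" if "i < length R" for i
    using that by (simp add: pos_def r_def)
  have pos_inj: "x mod r = y mod r" if "pos x = pos y" for x y
    using that nat_lt nth_eq_iff_index_eq[OF dist nat_lt nat_lt] mod_r
    by (metis pos_def eq_nat_nat_iff)
  have step: "adj (pos x) (pos (x + 1))" for x
  proof (cases "x mod r = r - 1")
    case True
    then have "(x + 1) mod r = 0" using r0 by (metis diff_add_cancel mod_add_left_eq mod_self)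
    moreover have "nat (r - 1) = length R - Suc 0" by (simp add: r_def)
    ultimately show ?thesis
      using True close ne by (simp add: pos_def last_conv_nth hd_conv_nth)
  next
    case False
    then have lt: "x mod r + 1 < r" using mod_r[of x] by linarith
    then have "(x + 1) mod r = x mod r + 1"
      using mod_r[of x] by (metis add_increasing2 mod_add_left_eq mod_pos_pos_trivial zero_le_one add.commute)
    then have "nat ((x + 1) mod r) = Suc (nat (x mod r))"
      using mod_r[of x] by (simp add: nat_add_distrib)
    moreover have "Suc (nat (x mod r)) < length R" using lt mod_r[of x] by (simp add: r_def)
    ultimately show ?thesis
      using succ by (simp add: pos_def successively_conv_nth)
  qed
  have step': "adj (pos (x + 1)) (pos x)" for x using step sym by blast
  define j where "j = int j0"
  have j: "2 \<le> j" "j + 2 \<le> r" and chord: "adj (pos 0) (pos j)"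
    using j0 pos_nat[of 0] pos_nat[of j0] ne by (auto simp: j_def r_def)
  have bippos: "pos x \<in> X \<longleftrightarrow> pos (x + 1) \<notin> X" for x
    using bip[OF pos_in pos_in step] .
  have par: "p (2 * i) \<in> X \<longleftrightarrow> p 0 \<in> X" if "path_in adj (set R) l p" "2 * i \<le> l" for p i
    using that(2)
  proof (induction i)
    case (Suc i)
    have "adj (p (2 * i)) (p (Suc (2 * i)))" "adj (p (Suc (2 * i))) (p (Suc (Suc (2 * i))))"
      "p (2 * i) \<in> set R" "p (Suc (2 * i)) \<in> set R" "p (Suc (Suc (2 * i))) \<in> set R"
      using that(1) Suc.prems by (auto simp: path_in_def)
    then have "p (Suc (Suc (2 * i))) \<in> X \<longleftrightarrow> p (2 * i) \<in> X"
      using bip by blast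
    then show ?case using Suc by simp
  qed simp
  have half: "p l \<in> W" if "path_in adj (set R) l p" "p 0 \<in> W" for p
  proof -
    have "p l \<in> X" using par[OF that(1), of "l div 2"] that(2) W l(1) by auto
    then show ?thesis using contra that by blast
  qed
  \<comment> \<open>Reversing the path turns the implication into an equivalence, also for ends
    outside \<open>X\<close>.\<close>
  have full: "p l \<in> W \<longleftrightarrow> p 0 \<in> W" if "path_in adj (set R) l p" for p
    using half[OF that] half[OF path_in_rev[OF that sym]] by auto
  \<comment> \<open>Paths are given by integer positions; staying within one window of length
    \<open>r\<close> keeps them injective after reduction modulo \<open>r\<close>.\<close>
  have main: "\<chi> (f l) = \<chi> (f 0)"
    if inj: "inj_on f {..l}" and rng: "\<And>i. i \<le> l \<Longrightarrow> c \<le> f i \<and> f i < c + r"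
      and ad: "\<And>i. i < l \<Longrightarrow> adj (pos (f i)) (pos (f (Suc i)))" for f :: "nat \<Rightarrow> int" and c
  proof -
    have "inj_on (\<lambda>i. pos (f i)) {..l}"
    proof (rule inj_onI)
      fix x y assume xy: "x \<in> {..l}" "y \<in> {..l}" "pos (f x) = pos (f y)"
      then have "f x = f y"
        using mod_eq_imp_eq[OF pos_inj[OF xy(3)], of c] rng[of x] rng[of y] by auto
      then show "x = y" using inj xy by (auto dest: inj_onD)
    qed
    then have "path_in adj (set R) l (\<lambda>i. pos (f i))"
      using pos_in ad by (auto simp: path_in_def)
    from full[OF this] show ?thesis by (simp add: \<chi>_def)
  qed
  have ll: "int l > 0" "int l < r" using l lenR by (auto simp: r_def)
  have "\<chi> (x + 2) = \<chi> x" for x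
  proof (rule chord_colouring_period_two[where r = r and l = "int l" and j = j and \<chi> = \<chi>])
    show "\<chi> (x + r) = \<chi> x" for x by (simp add: \<chi>_def pos_def)
    show "\<chi> (x + int l) = \<chi> x" for x
      using main[of "\<lambda>i. x + int i" x] step ll by (auto simp: inj_on_def add.assoc[symmetric] add.commute[of 1])
  next
    fix a b :: int assume ab: "0 \<le> a" "0 \<le> b" "a + b = int l - 1" "b < j" "a < r - j"
    define f where "f i = (if int i \<le> a then int i - a else j - (int i - a - 1))" for i
    have "\<chi> (f l) = \<chi> (f 0)"
    proof (rule main[where c = "- a"])
      show "inj_on f {..l}" using ab by (auto simp: inj_on_def f_def)
      show "- a \<le> f i \<and> f i < - a + r" if "i \<le> l" for i using ab that j by (auto simp: f_def)
      show "adj (pos (f i)) (pos (f (Suc i)))" if "i < l" for i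
      proof -
        consider "int i < a" | "int i = a" | "int i > a" by linarith
        then show ?thesis
        proof cases
          case 1 then show ?thesis using step[of "int i - a"] by (simp add: f_def algebra_simps)
        next
          case 2 then show ?thesis using chord by (simp add: f_def)
        next
          case 3 then show ?thesis using step'[of "j - (int i - a)"] by (simp add: f_def algebra_simps)
        qed
      qed
    qed
    moreover have "int l - a - 1 = b" "\<not> int l \<le> a" using ab by auto
    ultimately show "\<chi> (j - b) = \<chi> (- a)" using ab by (simp add: f_def)
  next
    fix a b :: int assume ab: "0 \<le> a" "0 \<le> b" "a + b = int l - 1" "a < j" "b < r - j"
    define f where "f i = (if int i \<le> a then a - int i else j + (int i - a - 1))" for i
    have "\<chi> (f l) = \<chi> (f 0)"
    proof (rule main[where c = 0])
      show "inj_on f {..l}" using ab by (auto simp: inj_on_def f_def)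
      show "0 \<le> f i \<and> f i < 0 + r" if "i \<le> l" for i using ab that j by (auto simp: f_def)
      show "adj (pos (f i)) (pos (f (Suc i)))" if "i < l" for i
      proof -
        consider "int i < a" | "int i = a" | "int i > a" by linarith
        then show ?thesis
        proof cases
          case 1 then show ?thesis using step'[of "a - int i - 1"] by (simp add: f_def algebra_simps)
        next
          case 2 then show ?thesis using chord by (simp add: f_def)
        next
          case 3 then show ?thesis using step[of "j + (int i - a - 1)"] by (simp add: f_def algebra_simps)
        qed
      qed
    qed
    moreover have "int l - a - 1 = b" "\<not> int l \<le> a" using ab by auto
    ultimately show "\<chi> (j + b) = \<chi> a" using ab by (simp add: f_def)
  next
    fix a b :: int assume ab: "0 \<le> a" "0 \<le> b" "a + b = int l - 1" "j + int l - 1 < r"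
    define f where "f i = (if int i \<le> a then int i - a else j + (int i - a - 1))" for i
    have "\<chi> (f l) = \<chi> (f 0)"
    proof (rule main[where c = "- a"])
      show "inj_on f {..l}" using ab j by (auto simp: inj_on_def f_def)
      show "- a \<le> f i \<and> f i < - a + r" if "i \<le> l" for i using ab that j by (auto simp: f_def)
      show "adj (pos (f i)) (pos (f (Suc i)))" if "i < l" for i
      proof -
        consider "int i < a" | "int i = a" | "int i > a" by linarith
        then show ?thesis
        proof cases
          case 1 then show ?thesis using step[of "int i - a"] by (simp add: f_def algebra_simps)
        next
          case 2 then show ?thesis using chord by (simp add: f_def)
        next
          case 3 then show ?thesis using step[of "j + (int i - a - 1)"] by (simp add: f_def algebra_simps)
        qed
      qed
    qed
    moreover have "int l - a - 1 = b" "\<not> int l \<le> a" using ab by auto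
    ultimately show "\<chi> (j + b) = \<chi> (- a)" using ab by (simp add: f_def)
  next
    fix a b :: int assume ab: "0 \<le> a" "0 \<le> b" "a + b = int l - 1" "int l - 1 < j"
    define f where "f i = (if int i \<le> a then a - int i else j - (int i - a - 1))" for i
    have "\<chi> (f l) = \<chi> (f 0)"
    proof (rule main[where c = 0])
      show "inj_on f {..l}" using ab j by (auto simp: inj_on_def f_def)
      show "0 \<le> f i \<and> f i < 0 + r" if "i \<le> l" for i using ab that j by (auto simp: f_def)
      show "adj (pos (f i)) (pos (f (Suc i)))" if "i < l" for i
      proof -
        consider "int i < a" | "int i = a" | "int i > a" by linarith
        then show ?thesis
        proof cases
          case 1 then show ?thesis using step'[of "a - int i - 1"] by (simp add: f_def algebra_simps)
        next
          case 2 then show ?thesis using chord by (simp add: f_def)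
        next
          case 3 then show ?thesis using step'[of "j - (int i - a)"] by (simp add: f_def algebra_simps)
        qed
      qed
    qed
    moreover have "int l - a - 1 = b" "\<not> int l \<le> a" using ab by auto
    ultimately show "\<chi> (j - b) = \<chi> a" using ab by (simp add: f_def)
  qed (use ll j in auto)
  then have per: "\<chi> (x + s * 2) = \<chi> x" for x s
    using periodic_multiple[of \<chi> 2 x s] by simp
  have Xpar: "pos (int i) \<in> X \<longleftrightarrow> (even i \<longleftrightarrow> pos 0 \<in> X)" for i
  proof (induction i)
    case (Suc i)
    then show ?case using bippos[of "int i"] by (auto simp: add.commute)
  qed simp
  obtain i1 where i1: "i1 < length R" "R ! i1 = w1" using w1 by (auto simp: in_set_conv_nth)
  obtain i2 where i2: "i2 < length R" "R ! i2 = w2" using w2 by (auto simp: in_set_conv_nth)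
  have "even i1 \<longleftrightarrow> even i2"
    using Xpar[of i1] Xpar[of i2] pos_nat[OF i1(1)] pos_nat[OF i2(1)] i1 i2 w1 w2 W by auto
  then have "even (int i2 - int i1)" by simp
  then obtain s where "int i2 - int i1 = 2 * s" by (rule evenE)
  then have "int i2 = int i1 + s * 2" by simp
  then have "\<chi> (int i2) = \<chi> (int i1)" using per[of "int i1" s] by simp
  then show False
    using pos_nat[OF i1(1)] pos_nat[OF i2(1)] i1 i2 w1 w2 by (simp add: \<chi>_def)
qed

section \<open>Closing a path through the search tree\<close>

text \<open>Let \<open>h\<close> be least such that all level-\<open>i\<close> vertices of \<open>R\<close> have the same \<open>h\<close>-th ancestor (the first
  ancestor being chosen off \<open>R\<close>). Two of them with different \<open>(h-1)\<close>-st ancestors are joined in \<open>R\<close> by a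
  path of length \<open>2k - 2h\<close>, which the two ancestral lines close to a cycle.\<close>

lemma cycle_through_ancestors:
  fixes lev :: "'a \<Rightarrow> nat"
  assumes th: "theta adj k R" and sym: "\<And>u v. adj u v \<Longrightarrow> adj v u"
    and lev: "\<And>u v. u \<in> set R \<Longrightarrow> v \<in> set R \<Longrightarrow> adj u v \<Longrightarrow> lev u = i \<longleftrightarrow> lev v \<noteq> i"
    and levR: "\<And>v. v \<in> set R \<Longrightarrow> i \<le> Suc (lev v)"
    and par: "\<And>v. v \<in> V \<Longrightarrow> 0 < lev v \<Longrightarrow> par v \<in> V \<and> adj v (par v) \<and> Suc (lev (par v)) = lev v"
    and root: "\<And>u v. u \<in> V \<Longrightarrow> v \<in> V \<Longrightarrow> lev u = 0 \<Longrightarrow> lev v = 0 \<Longrightarrow> u = v"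
    and R: "set R \<subseteq> V" and i: "0 < i" "i < k"
    and wp: "\<And>v. v \<in> set R \<Longrightarrow> lev v = i \<Longrightarrow> \<exists>u. u \<in> V \<and> u \<notin> set R \<and> adj v u \<and> Suc (lev u) = i"
  shows "\<exists>f. inj_on f {..<2 * k} \<and> f ` {..<2 * k} \<subseteq> V \<and> (\<forall>s<2 * k. adj (f s) (f (Suc s mod (2 * k))))"
proof -
  obtain g where g: "\<And>v. v \<in> set R \<Longrightarrow> lev v = i \<Longrightarrow> g v \<in> V \<and> g v \<notin> set R \<and> adj v (g v) \<and> Suc (lev (g v)) = i"
    using wp by metis
  define anc where "anc h v = (case h of 0 \<Rightarrow> v | Suc h' \<Rightarrow> (par ^^ h') (g v))" for h v
  define X where "X = {v \<in> set R. lev v = i}"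
  have anc: "anc (Suc h) v \<in> V \<and> lev (anc (Suc h) v) + Suc h = i \<and> (Suc h < i \<longrightarrow> adj (anc (Suc h) v) (anc (Suc (Suc h)) v))"
    if v: "v \<in> X" and h: "Suc h \<le> i" for h v
    using h
  proof (induction h)
    case 0
    then show ?case using v g[of v] par[of "g v"] by (auto simp: anc_def X_def)
  next
    case (Suc h)
    then have IH: "anc (Suc h) v \<in> V" "lev (anc (Suc h) v) + Suc h = i" by auto
    have e: "anc (Suc (Suc h)) v = par (anc (Suc h) v)" for h by (simp add: anc_def)
    have 1: "anc (Suc (Suc h)) v \<in> V" "Suc (lev (anc (Suc (Suc h)) v)) = lev (anc (Suc h) v)"
      using par[OF IH(1)] IH(2) Suc.prems by (auto simp: e)
    then have "Suc (Suc h) < i \<longrightarrow> adj (anc (Suc (Suc h)) v) (anc (Suc (Suc (Suc h))) v)"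
      using par[OF 1(1)] IH(2) by (auto simp: e)
    then show ?case using 1 IH(2) by auto
  qed
  have anc0: "anc 0 v = v" for v by (simp add: anc_def)
  have anc_in: "anc h v \<in> V" if "v \<in> X" "h \<le> i" for h v
    using anc[OF that(1)] that R by (cases h) (auto simp: anc0 X_def)
  have anc_lev: "lev (anc h v) = i - h" if "v \<in> X" "h \<le> i" for h v
    using anc[OF that(1), of "h - 1"] that by (cases h) (auto simp: anc0 X_def)
  have anc_adj: "adj (anc h v) (anc (Suc h) v)" if "v \<in> X" "h < i" for h v
    using anc[OF that(1), of "h - 1"] that g[of v] by (cases h) (auto simp: anc_def X_def)
  \<comment> \<open>Only the first ancestor needs \<open>wp\<close>: from the second on, the level
    is below \<open>i - 1\<close>, where \<open>levR\<close> leaves no vertex of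
    \<open>R\<close>.\<close>
  have anc_notin: "anc h v \<notin> set R" if "v \<in> X" "h \<le> i" "0 < h" for h v
  proof (cases "h = 1")
    case True then show ?thesis using g[of v] that by (auto simp: anc_def X_def)
  next
    case False
    then show ?thesis using anc_lev[OF that(1,2)] levR[of "anc h v"] that by auto
  qed
  have distR: "distinct R" and lenR: "2 * k \<le> length R" and sucR: "successively adj R"
    using th by (auto simp: theta_def)
  have len4: "4 \<le> length R" using lenR i by linarith
  have e01: "adj (R ! 0) (R ! 1)" "adj (R ! 1) (R ! 2)" "adj (R ! 2) (R ! 3)"
    using sucR len4 by (auto simp: successively_conv_nth numeral_eq_Suc)
  have in03: "R ! 0 \<in> set R" "R ! 1 \<in> set R" "R ! 2 \<in> set R" "R ! 3 \<in> set R"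
    using len4 by (auto intro!: nth_mem)
  \<comment> \<open>Exactly one end of each edge of \<open>R\<close> has level \<open>i\<close>, so
    four consecutive vertices contain two of that level; this makes \<open>h\<close> below
    positive.\<close>
  have "R ! 0 \<in> X \<and> R ! 2 \<in> X \<or> R ! 1 \<in> X \<and> R ! 3 \<in> X"
    using lev[OF in03(1,2) e01(1)] lev[OF in03(2,3) e01(2)] lev[OF in03(3,4) e01(3)] in03
    by (auto simp: X_def)
  moreover have "R ! 0 \<noteq> R ! 2" "R ! 1 \<noteq> R ! 3"
    using nth_eq_iff_index_eq[OF distR, of 0 2] nth_eq_iff_index_eq[OF distR, of 1 3] len4 by (simp_all add: Suc_le_eq length_greater_0_conv[symmetric] del: length_greater_0_conv)
  ultimately obtain x0 y0 where xy0: "x0 \<in> X" "y0 \<in> X" "x0 \<noteq> y0" by blast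
  define const where "const h \<longleftrightarrow> (\<forall>u\<in>X. \<forall>v\<in>X. anc h u = anc h v)" for h
  have "const i" unfolding const_def
    using anc_in anc_lev root by (metis diff_self_eq_0 order_refl)
  then obtain h where h: "const h" "\<And>h'. h' < h \<Longrightarrow> \<not> const h'" "h \<le> i"
    by (metis LeastI_ex Least_le not_less_Least)
  have "h \<noteq> 0" using h(1) xy0 unfolding const_def by (metis anc0)
  then obtain h' where h': "h = Suc h'" by (cases h) auto
  then obtain x y where xy: "x \<in> X" "y \<in> X" "anc h' x \<noteq> anc h' y"
    using h(2)[of h'] by (auto simp: const_def)
  define W where "W = {v \<in> X. anc h' v = anc h' x}"
  \<comment> \<open>\<open>1 \<le> h \<le> i < k\<close> places \<open>l\<close> between 2 and
    \<open>2 * k - 2\<close>; two ancestral lines of length \<open>h\<close> complete the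
    cycle.\<close>
  define l where "l = 2 * k - 2 * h"
  have l: "even l" "0 < l" "l + 2 \<le> 2 * k" "l + 2 * h = 2 * k"
    using h(3) i h' by (auto simp: l_def)
  obtain p where p: "path_in adj (set R) l p" "p 0 \<in> W" "p l \<in> X" "p l \<notin> W"
    using theta_path_between[OF th sym, where X = X and W = W and ?w1.0 = x and ?w2.0 = y and l = l]
      lev xy l by (auto simp: W_def X_def)
  define u where "u = p 0"
  define v where "v = p l"
  have uv: "u \<in> X" "v \<in> X" using p by (auto simp: u_def v_def W_def)
  \<comment> \<open>Once two ancestral lines meet they stay together, so meeting before step
    \<open>h\<close> would make the ancestors at \<open>h'\<close> equal.\<close>
  have diff: "anc s u \<noteq> anc s v" if "s < h" for s
  proof
    assume eq: "anc s u = anc s v"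
    have "anc (s + t) u = anc (s + t) v" for t
    proof (cases s)
      case 0
      then show ?thesis using eq by (simp add: anc0)
    next
      case (Suc s')
      have "s + t = Suc (t + s')" using Suc by simp
      then have "anc (s + t) w = (par ^^ t) (anc s w)" for w
        using Suc by (simp only: anc_def nat.case funpow_add o_apply)
      then show ?thesis using eq by simp
    qed
    from this[of "h' - s"] that h' have "anc h' u = anc h' v" by simp
    then show False using p uv by (auto simp: W_def u_def v_def)
  qed
  have eqh: "anc h u = anc h v" using h(1) uv unfolding const_def by blast
  define f where "f s = (if s \<le> l then p s else if s \<le> l + h then anc (s - l) v else anc (2 * k - s) u)" for s
  have pR: "p s \<in> set R" if "s \<le> l" for s using p(1) that by (auto simp: path_in_def)
  have pinj: "inj_on p {..l}" using p(1) by (simp add: path_in_def)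
  have padj: "adj (p s) (p (Suc s))" if "s < l" for s using p(1) that by (auto simp: path_in_def)
  have f_R: "f s = p s" if "s \<le> l" for s using that by (simp add: f_def)
  have f_v: "f s = anc (s - l) v" if "l < s" "s \<le> l + h" for s using that by (simp add: f_def)
  have f_u: "f s = anc (2 * k - s) u" if "l + h < s" for s using that by (simp add: f_def)
  have inj: "s = t" if st: "s \<le> t" "t < 2 * k" "f s = f t" for s t
  proof -
    consider "t \<le> l" | "s \<le> l" "l < t" | "l < s" "t \<le> l + h" | "l < s" "s \<le> l + h" "l + h < t" | "l + h < s"
      by linarith
    then show ?thesis
    proof cases
      case 1 then show ?thesis using st pinj by (auto simp: f_def dest: inj_onD)
    next
      case 2
      have "f t \<notin> set R"
        using anc_notin[OF uv(1), of "2 * k - t"] anc_notin[OF uv(2), of "t - l"] 2 st h(3) l by (auto simp: f_def)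
      then show ?thesis using pR[of s] 2 st by (auto simp: f_def)
    next
      case 3
      then have "anc (s - l) v = anc (t - l) v" using st by (simp add: f_def)
      then have "i - (s - l) = i - (t - l)" using anc_lev[OF uv(2), of "s - l"] anc_lev[OF uv(2), of "t - l"] 3 st h(3) by auto
      then show ?thesis using 3 st h(3) by linarith
    next
      case 4
      then have e: "anc (s - l) v = anc (2 * k - t) u" using st by (simp add: f_def)
      then have "i - (s - l) = i - (2 * k - t)"
        using anc_lev[OF uv(2), of "s - l"] anc_lev[OF uv(1), of "2 * k - t"] 4 st h(3) l by auto
      then have "s - l = 2 * k - t" using 4 st h(3) l by linarith
      moreover have "2 * k - t < h" using 4 st l h(3) by linarith
      ultimately show ?thesis using e diff[of "2 * k - t"] by metis
    next
      case 5
      then have "anc (2 * k - s) u = anc (2 * k - t) u" using st by (simp add: f_def)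
      then have "i - (2 * k - s) = i - (2 * k - t)"
        using anc_lev[OF uv(1), of "2 * k - s"] anc_lev[OF uv(1), of "2 * k - t"] 5 st h(3) l by auto
      then show ?thesis using 5 st h(3) l by linarith
    qed
  qed
  have "inj_on f {..<2 * k}"
    by (rule inj_onI) (metis inj lessThan_iff linear)
  moreover have "f ` {..<2 * k} \<subseteq> V"
    using pR R anc_in uv h(3) l by (auto simp: f_def)
  moreover have "adj (f s) (f (Suc s mod (2 * k)))" if s: "s < 2 * k" for s
  proof -
    have f0: "f (2 * k) = f 0" using l h' by (simp add: f_def anc0 u_def)
    have "f (Suc s mod (2 * k)) = f (Suc s)"
    proof (cases "Suc s = 2 * k")
      case False then show ?thesis using s by simp
    qed (simp add: f0)
    moreover have "adj (f s) (f (Suc s))"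
    proof -
      consider "s < l" | "l \<le> s" "s < l + h" | "l + h \<le> s" by linarith
      then show ?thesis
      proof cases
        case 1 then show ?thesis using padj by (simp add: f_def)
      next
        case 2
        have "f s = anc (s - l) v" using 2 by (auto simp: f_def anc0 v_def)
        moreover have "f (Suc s) = anc (Suc (s - l)) v" using 2 by (auto simp: f_def Suc_diff_le)
        ultimately show ?thesis using anc_adj[OF uv(2), of "s - l"] 2 h(3) by auto
      next
        case 3
        have 1: "2 * k - s = Suc (2 * k - Suc s)" "2 * k - Suc s < i" using s 3 l h' h(3) by linarith+
        have "f s = anc (2 * k - s) u"
        proof (cases "s = l + h")
          case True
          moreover have "2 * k - (l + h) = h" using l by linarith
          ultimately show ?thesis using eqh h' by (simp add: f_def)
        next
          case False then show ?thesis using 3 by (simp add: f_def)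
        qed
        moreover have "f (Suc s) = anc (2 * k - Suc s) u" using 3 h' by (simp add: f_def)
        ultimately show ?thesis using sym[OF anc_adj[OF uv(1) 1(2)]] 1(1) by simp
      qed
    qed
    ultimately show ?thesis by simp
  qed
  ultimately show ?thesis by blast
qed

section \<open>Dense bipartite graphs\<close>

text \<open>Take a longest path. All neighbours of its first vertex lie on it, at odd positions by
  bipartiteness, so the farthest of at least \<open>k\<close> of them is at position
  \<open>2 * k - 1\<close> or later and closes a long cycle. As \<open>k\<close> is at least 3, some
  neighbour is neither the second vertex nor the farthest one and gives the chord.\<close>

lemma theta_if_min_degree:
  assumes fin: "finite U" and ne: "U \<noteq> {}" and sym: "\<And>u v. adj u v \<Longrightarrow> adj v u"
    and bip: "\<And>u v. adj u v \<Longrightarrow> u \<in> X \<longleftrightarrow> v \<notin> X"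
    and deg: "\<And>v. v \<in> U \<Longrightarrow> k \<le> card {u \<in> U. adj v u}" and k: "3 \<le> k"
  shows "\<exists>R. theta adj k R \<and> set R \<subseteq> U"
proof -
  let ?P = "\<lambda>R. distinct R \<and> successively adj R \<and> set R \<subseteq> U \<and> R \<noteq> []"
  obtain v0 where "v0 \<in> U" using ne by blast
  then have ex: "?P [v0]" by simp
  have bound: "length R < Suc (card U)" if "?P R" for R
    using that card_mono[OF fin, of "set R"] distinct_card[of R] by simp
  obtain R where R: "?P R" "\<And>R'. ?P R' \<Longrightarrow> length R' \<le> length R"
    using ex_has_greatest_nat[of ?P "[v0]" length, OF ex] bound by blast
  define x where "x = hd R"
  define N where "N = {u \<in> U. adj x u}"
  have x: "R ! 0 = x" "x \<in> U" using R(1) by (auto simp: x_def hd_conv_nth)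
  have NR: "N \<subseteq> set R"
  proof
    fix u assume u: "u \<in> N"
    show "u \<in> set R"
    proof (rule ccontr)
      assume "u \<notin> set R"
      then have "?P (u # R)" using R(1) u sym by (auto simp: N_def x_def successively_Cons)
      then show False using R(2)[of "u # R"] by simp
    qed
  qed
  define I where "I = {i. i < length R \<and> R ! i \<in> N}"
  have "N = (\<lambda>i. R ! i) ` I" using NR by (auto simp: I_def in_set_conv_nth subset_iff image_iff)
  moreover have finI: "finite I" by (simp add: I_def)
  ultimately have cardI: "k \<le> card I"
    using card_image_le[of I "\<lambda>i. R ! i"] deg[OF x(2)] by (simp add: N_def)
  have parity: "R ! i \<in> X \<longleftrightarrow> (even i \<longleftrightarrow> x \<in> X)" if "i < length R" for i
    using that
  proof (induction i)
    case (Suc i)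
    have "adj (R ! i) (R ! Suc i)" using R(1) Suc.prems by (auto simp: successively_conv_nth)
    then show ?case using Suc bip by auto
  qed (simp add: x)
  have odd: "odd i" if "i \<in> I" for i
    using that parity[of i] bip[of x "R ! i"] by (auto simp: I_def N_def)
  define f where "f = Max I"
  have "I \<noteq> {}" using cardI k by auto
  then have f: "f \<in> I" "\<And>i. i \<in> I \<Longrightarrow> i \<le> f" using finI by (auto simp: f_def)
  have "I \<subseteq> (\<lambda>t. 2 * t + 1) ` {..<(f + 1) div 2}"
  proof
    fix i assume i: "i \<in> I"
    then obtain t where t: "i = 2 * t + 1" using odd by (blast elim: oddE)
    then show "i \<in> (\<lambda>t. 2 * t + 1) ` {..<(f + 1) div 2}" using f(2)[OF i] by auto
  qed
  then have "card I \<le> (f + 1) div 2"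
    using surj_card_le[of "{..<(f + 1) div 2}" I] by simp
  then have len: "2 * k \<le> f + 1" using cardI by linarith
  have "\<not> I \<subseteq> {1, f}" using cardI k card_mono[of "{1, f}" I] card_insert_le_m1[of 2 "{f}" 1] by auto
  then obtain j where j: "j \<in> I" "j \<noteq> 1" "j \<noteq> f" by blast
  have j2: "2 \<le> j" "j + 2 \<le> f + 1" using odd[OF j(1)] odd[OF f(1)] f(2)[OF j(1)] j by presburger+
  have fl: "f < length R" using f by (simp add: I_def)
  let ?R = "take (f + 1) R"
  have "theta adj k ?R"
    unfolding theta_def
  proof (intro conjI exI[of _ j])
    show "distinct ?R" using R(1) by simp
    show "successively adj ?R" using R(1) by (auto simp: successively_conv_nth)
    show "2 * k \<le> length ?R" using fl len by simp
    have "last ?R = R ! f" using fl by (subst last_conv_nth) auto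
    moreover have "hd ?R = x" using R(1) by (simp add: x_def)
    ultimately show "adj (last ?R) (hd ?R)" using f(1) sym by (auto simp: I_def N_def)
    show "2 \<le> j" "j + 2 \<le> length ?R" using j2 fl by auto
    show "adj (?R ! 0) (?R ! j)" using j(1) j2 x by (auto simp: I_def N_def)
  qed
  moreover have "set ?R \<subseteq> U" using R(1) by (meson order_trans set_take_subset)
  ultimately show ?thesis by blast
qed

lemma finite_has_maximizer:
  fixes g :: "'b \<Rightarrow> 'c::linorder"
  assumes "finite A" and "A \<noteq> {}"
  obtains x where "x \<in> A" and "\<And>y. y \<in> A \<Longrightarrow> g y \<le> g x"
proof -
  have "Max (g ` A) \<in> g ` A" using assms by (intro Max_in) auto
  then obtain x where x: "x \<in> A" "Max (g ` A) = g x" by (rule imageE)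
  show ?thesis
  proof
    show "x \<in> A" by (rule x)
    show "g y \<le> g x" if "y \<in> A" for y
      unfolding x(2)[symmetric] using assms(1) that by (intro Max_ge) auto
  qed
qed

lemma theta_if_dense:
  fixes F :: "('a \<times> 'a) set"
  assumes fin: "finite S" "finite T" and disj: "S \<inter> T = {}" and F: "F \<subseteq> S \<times> T" and k: "3 \<le> k"
    and dense: "(k - 1) * (card S + card T) < card F"
  shows "\<exists>R. theta (\<lambda>u v. (u, v) \<in> F \<or> (v, u) \<in> F) k R \<and> set R \<subseteq> S \<union> T"
proof -
  let ?adj = "\<lambda>u v. (u, v) \<in> F \<or> (v, u) \<in> F"
  let ?E = "\<lambda>U. {(u, v) \<in> F. u \<in> U \<and> v \<in> U}"
  define M where "M = int (card (S \<union> T)) + 1"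
  \<comment> \<open>The summand \<open>- card U\<close> breaks ties: without it a maximal \<open>U\<close> only has minimum degree \<open>k - 1\<close>.\<close>
  define \<phi> where "\<phi> U = M * int (card (?E U)) - (M * int (k - 1) + 1) * int (card U)" for U
  have finF: "finite F" using F fin by (meson finite_SigmaI finite_subset)
  have "finite (Pow (S \<union> T))" "Pow (S \<union> T) \<noteq> {}" using fin by auto
  then obtain U where "U \<in> Pow (S \<union> T)" "\<And>U'. U' \<in> Pow (S \<union> T) \<Longrightarrow> \<phi> U' \<le> \<phi> U"
    using finite_has_maximizer[of "Pow (S \<union> T)" \<phi>] by blast
  then have U: "U \<subseteq> S \<union> T" "\<And>U'. U' \<subseteq> S \<union> T \<Longrightarrow> \<phi> U' \<le> \<phi> U" by auto
  \<comment> \<open>Strictness in \<open>dense\<close> gains at least \<open>M\<close>, one more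
    than the tie-breaking term costs.\<close>
  have "\<phi> (S \<union> T) > 0"
  proof -
    have "?E (S \<union> T) = F" using F by auto
    moreover have "int (card F) \<ge> int (k - 1) * int (card (S \<union> T)) + 1"
    proof -
      have "Suc ((k - 1) * card (S \<union> T)) \<le> card F"
        using dense fin disj by (simp add: card_Un_disjoint)
      then have "int (Suc ((k - 1) * card (S \<union> T))) \<le> int (card F)" by linarith
      then show ?thesis by simp
    qed
    then have "M * int (card F) \<ge> M * (int (k - 1) * int (card (S \<union> T)) + 1)"
      by (intro mult_left_mono) (auto simp: M_def)
    ultimately show ?thesis by (simp add: \<phi>_def M_def algebra_simps)
  qed
  then have pos: "\<phi> U > 0" using U(2)[of "S \<union> T"] by auto
  have finU: "finite U" using U(1) fin by (meson finite_UnI finite_subset)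
  have ne: "U \<noteq> {}" using pos by (auto simp: \<phi>_def)
  have deg: "k \<le> card {u \<in> U. ?adj v u}" if v: "v \<in> U" for v
  proof -
    let ?D = "{u \<in> U. ?adj v u}"
    have "?E U \<subseteq> ?E (U - {v}) \<union> (\<lambda>u. if v \<in> S then (v, u) else (u, v)) ` ?D"
      using F disj by auto
    then have "card (?E U) \<le> card (?E (U - {v}) \<union> (\<lambda>u. if v \<in> S then (v, u) else (u, v)) ` ?D)"
      using finF finU by (intro card_mono) (auto intro: rev_finite_subset[OF finF])
    also have "\<dots> \<le> card (?E (U - {v})) + card ?D"
      by (rule order_trans[OF card_Un_le add_left_mono[OF card_image_le]]) (use finU in simp)
    finally have 1: "card (?E U) \<le> card (?E (U - {v})) + card ?D" .
    have 2: "card U = Suc (card (U - {v}))" using card.remove[OF finU v] .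
    have "\<phi> (U - {v}) \<le> \<phi> U" using U by blast
    then have "M * int (card (?E (U - {v}))) + (M * int (k - 1) + 1) \<le> M * int (card (?E U))"
      unfolding \<phi>_def 2 by (simp add: algebra_simps)
    also have "\<dots> \<le> M * (int (card (?E (U - {v}))) + int (card ?D))"
      using 1 by (intro mult_left_mono) (auto simp: M_def)
    finally have "M * int (k - 1) < M * int (card ?D)" by (simp add: algebra_simps)
    then have "k - 1 < card ?D" by (simp add: M_def)
    then show ?thesis by linarith
  qed
  have "\<exists>R. theta ?adj k R \<and> set R \<subseteq> U"
    by (rule theta_if_min_degree[OF finU ne, where X = S]) (use deg k F disj in auto)
  then show ?thesis using U(1) by blast
qed

section \<open>Three layers\<close>

lemma spaced_card_le:
  fixes I :: "nat set"
  assumes "I \<subseteq> {lo..hi}" and "\<And>a b. a \<in> I \<Longrightarrow> b \<in> I \<Longrightarrow> a < b \<Longrightarrow> a + s \<le> b" and "Suc n \<le> card I"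
  shows "lo + n * s \<le> hi"
  using assms
proof (induction n arbitrary: I hi)
  case 0
  then have "I \<noteq> {}" by auto
  then show ?case using 0(1) by fastforce
next
  case (Suc n)
  have fin: "finite I" using Suc.prems(1) finite_subset by blast
  have ne: "I \<noteq> {}" using Suc.prems(3) by auto
  define M where "M = Max I"
  have M: "M \<in> I" "\<And>i. i \<in> I \<Longrightarrow> i \<le> M" using fin ne by (auto simp: M_def)
  have sub: "a + s \<le> M" if "a \<in> I - {M}" for a
    using Suc.prems(2)[of a M] M that by (simp add: order_less_le)
  have "Suc n \<le> card (I - {M})" using Suc.prems(3) M(1) fin by simp
  moreover have "I - {M} \<subseteq> {lo..M - s}"
    using Suc.prems(1) sub by fastforce
  ultimately have "lo + n * s \<le> M - s"
    using Suc.prems(2) by (intro Suc.IH) auto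
  moreover have "s \<le> M"
  proof -
    have "I - {M} \<noteq> {}"
      using \<open>Suc n \<le> card (I - {M})\<close> by (metis Zero_not_Suc card.empty le_zero_eq)
    then show ?thesis using sub by fastforce
  qed
  ultimately show ?case using M(1) Suc.prems(1) by fastforce
qed

lemma card_nth_preimage:
  assumes "distinct L"
  shows "card {i. i < length L \<and> L ! i \<in> N} = card (N \<inter> set L)"
proof -
  have "(!) L ` {i. i < length L \<and> L ! i \<in> N} = N \<inter> set L"
    by (auto simp: in_set_conv_nth)
  moreover have "inj_on ((!) L) {i. i < length L \<and> L ! i \<in> N}"
    using inj_on_nth[OF assms] by simp
  ultimately show ?thesis using card_image[of "(!) L" "{i. i < length L \<and> L ! i \<in> N}"] by simp
qed

lemma card_Int_set_split:
  "card (N \<inter> set P) \<le> card (N \<inter> set (take i P)) + card (N \<inter> set (drop i P))"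
proof -
  have "set P = set (take i P) \<union> set (drop i P)"
    by (simp only: set_append[symmetric] append_take_drop_id)
  then have "N \<inter> set P = (N \<inter> set (take i P)) \<union> (N \<inter> set (drop i P))" by blast
  then show ?thesis using card_Un_le[of "N \<inter> set (take i P)" "N \<inter> set (drop i P)"] by simp
qed

text \<open>The last assumption excludes only well-placed cycles with a chord: those all of whose vertices in the
  middle layer \<open>S2\<close> have a neighbour in \<open>S1\<close> off the cycle. A path is a list whose head is the end being
  extended. If \<open>S1\<close> were nonempty, some path could be extended forever.\<close>

locale trilayer =
  fixes adj :: "'a \<Rightarrow> 'a \<Rightarrow> bool" and S1 S2 S3 :: "'a set" and k c D m :: nat
  assumes sym: "adj u v \<Longrightarrow> adj v u"
    and fin: "finite S1" "finite S2" "finite S3"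
    and disj: "S1 \<inter> S2 = {}" "S1 \<inter> S3 = {}" "S2 \<inter> S3 = {}"
    and c: "3 \<le> c" and D: "3 \<le> D" "D \<le> k" and cD: "k - 1 \<le> (c - 1) * D" and m: "24 * k \<le> m"
    and deg12: "v \<in> S1 \<Longrightarrow> (8 * k) ^ (k + 2) \<le> card {u \<in> S2. adj v u}"
    and deg21: "v \<in> S2 \<Longrightarrow> 2 * c \<le> card {u \<in> S1. adj v u}"
    and deg23: "v \<in> S2 \<Longrightarrow> m \<le> 2 * card {u \<in> S3. adj v u}"
    and deg23_le: "v \<in> S2 \<Longrightarrow> card {u \<in> S3. adj v u} \<le> m"
    and deg32: "v \<in> S3 \<Longrightarrow> D \<le> card {u \<in> S2. adj v u}"
    and no_theta: "theta adj k R \<Longrightarrow> set R \<subseteq> S1 \<union> S2 \<union> S3 \<Longrightarrow>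
      (\<And>w. w \<in> set R \<Longrightarrow> w \<in> S2 \<Longrightarrow> \<exists>u\<in>S1. u \<notin> set R \<and> adj w u) \<Longrightarrow> False"
begin

definition N1 :: "'a \<Rightarrow> 'a set" where
  "N1 w = {u \<in> S1. adj w u}"

lemma k3: "3 \<le> k" using D by simp

lemma finite_N1 [simp]: "finite (N1 w)" using fin by (simp add: N1_def)

definition spaced :: "'a list \<Rightarrow> bool" where
  "spaced P \<longleftrightarrow> distinct P \<and> successively adj P \<and> set P \<subseteq> S1 \<union> S2 \<union> S3 \<and>
     (\<forall>a b. a < b \<longrightarrow> b < length P \<longrightarrow> P ! a \<in> S1 \<longrightarrow> P ! b \<in> S1 \<longrightarrow> a + 2 * D \<le> b)"

lemma spaced_tl:
  assumes "spaced (x # P)"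
  shows "spaced P"
proof -
  have "a + 2 * D \<le> b" if "a < b" "b < length P" "P ! a \<in> S1" "P ! b \<in> S1" for a b
  proof -
    have "Suc a + 2 * D \<le> Suc b"
      using assms that unfolding spaced_def by (metis Suc_less_eq length_Cons nth_Cons_Suc)
    then show ?thesis by simp
  qed
  then show ?thesis using assms by (auto simp: spaced_def successively_Cons)
qed

lemma spaced_take:
  assumes "spaced P"
  shows "spaced (take n P)"
  using assms set_take_subset[of n P] unfolding spaced_def
  by (auto simp: successively_conv_nth)

lemma spaced_rev:
  assumes "spaced P"
  shows "spaced (rev P)"
proof -
  have "a + 2 * D \<le> b" if "a < b" "b < length P" "rev P ! a \<in> S1" "rev P ! b \<in> S1" for a b
  proof -
    have "P ! (length P - Suc b) \<in> S1" "P ! (length P - Suc a) \<in> S1"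
      using that by (auto simp: rev_nth)
    moreover have "length P - Suc b < length P - Suc a" "length P - Suc a < length P"
      using that by auto
    ultimately have "(length P - Suc b) + 2 * D \<le> length P - Suc a"
      using assms unfolding spaced_def by blast
    then show ?thesis using that by linarith
  qed
  then show ?thesis
    using assms sym by (auto simp: spaced_def successively_rev intro: successively_mono)
qed

lemma spaced_Cons:
  assumes "spaced P" "P \<noteq> []" "x \<notin> set P" "adj x (hd P)" "x \<in> S2 \<union> S3"
  shows "spaced (x # P)"
  unfolding spaced_def
proof (intro conjI allI impI)
  fix a b assume ab: "a < b" "b < length (x # P)" "(x # P) ! a \<in> S1" "(x # P) ! b \<in> S1"
  show "a + 2 * D \<le> b"
  proof (cases a)
    case 0
    then show ?thesis using ab assms(5) disj by auto
  next
    case (Suc a')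
    then obtain b' where b': "b = Suc b'" using ab by (cases b) auto
    then have "a' + 2 * D \<le> b'" using ab Suc assms(1) unfolding spaced_def by auto
    then show ?thesis using Suc b' by simp
  qed
qed (use assms in \<open>auto simp: spaced_def successively_Cons\<close>)

lemma off_path_nbr:
  assumes "w \<in> S2" "card (N1 w \<inter> set L) < 2 * c"
  shows "\<exists>u\<in>S1. u \<notin> set L \<and> adj w u"
proof (rule ccontr)
  assume "\<not> ?thesis"
  then have "N1 w \<inter> set L = N1 w" by (auto simp: N1_def)
  then show False using assms deg21[of w] by (simp add: N1_def)
qed

text \<open>The \<open>c\<close> neighbours are \<open>2 * D\<close> apart and none is the head, so
  the last of them is at position at least \<open>1 + (c - 1) * (2 * D)\<close>, which
  \<open>cD\<close> makes at least \<open>2 * k - 1\<close>. As \<open>c\<close> is at least 3, a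
  further neighbour serves as the end of a chord.\<close>

lemma no_theta_at_hd:
  assumes L: "spaced L" and x: "hd L \<in> S2" and last: "last L \<in> N1 (hd L)"
    and cnt: "card (N1 (hd L) \<inter> set L) = c"
    and wp: "\<And>w. w \<in> set L \<Longrightarrow> w \<in> S2 \<Longrightarrow> \<exists>u\<in>S1. u \<notin> set L \<and> adj w u"
  shows False
proof -
  define f where "f = length L - 1"
  define I where "I = {i. i < length L \<and> L ! i \<in> N1 (hd L)}"
  have ne: "L \<noteq> []" using cnt c by auto
  have h0: "hd L = L ! 0" using ne by (simp add: hd_conv_nth)
  have cardI: "card I = c" using card_nth_preimage[of L "N1 (hd L)"] L cnt by (simp add: I_def spaced_def)
  have spI: "a + 2 * D \<le> b" if "a \<in> I" "b \<in> I" "a < b" for a b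
    using that L unfolding spaced_def I_def N1_def by auto
  have "0 \<notin> I" using x disj by (auto simp: I_def h0 N1_def)
  have sub: "I \<subseteq> {1..f}"
  proof
    fix i assume i: "i \<in> I"
    then have "i \<noteq> 0" using \<open>0 \<notin> I\<close> by metis
    then show "i \<in> {1..f}" using i by (auto simp: I_def f_def)
  qed
  have fI: "f \<in> I" using last ne by (auto simp: I_def f_def last_conv_nth)
  have "1 + (c - 1) * (2 * D) \<le> f"
    by (rule spaced_card_le[OF sub spI]) (use cardI c in auto)
  moreover have "2 * (k - 1) \<le> (c - 1) * (2 * D)" using cD by simp
  ultimately have len: "2 * k \<le> f + 1" using k3 by linarith
  have finI: "finite I" by (simp add: I_def)
  have "\<not> card (I - {f}) \<le> Suc 0" using cardI c fI finI by simp
  then obtain a b where ab: "a \<in> I" "b \<in> I" "a \<noteq> f" "b \<noteq> f" "a < b"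
    using card_le_Suc0_iff_eq[of "I - {f}"] finI by (metis Diff_iff finite_Diff insertI1 linorder_neqE_nat)
  have "1 \<le> a" "b < f" using ab sub by fastforce+
  then have b: "2 \<le> b" "b + 2 \<le> f + 1" using spI[OF ab(1,2,5)] spI[OF ab(2) fI] D by auto
  have "theta adj k L"
    unfolding theta_def
  proof (intro conjI exI[of _ b])
    show "distinct L" "successively adj L" using L by (auto simp: spaced_def)
    show "2 * k \<le> length L" "2 \<le> b" "b + 2 \<le> length L" using len b f_def ne by auto
    show "adj (last L) (hd L)" using last sym by (auto simp: N1_def)
    show "adj (L ! 0) (L ! b)" using ab(2) by (auto simp: I_def N1_def h0)
  qed
  then show False using no_theta L wp by (auto simp: spaced_def)
qed

text \<open>Visits to \<open>S1\<close> are at least \<open>2D\<close> apart, so \<open>c\<close> neighbours of \<open>P ! b\<close> on one side of it span a cycle of length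
  at least \<open>2k\<close>, and one with exactly \<open>c\<close> of the neighbours of \<open>P ! b\<close> is well placed.\<close>

lemma few_before_and_after:
  assumes "spaced P" "b < length P" "P ! b \<in> S2"
  shows "card (N1 (P ! b) \<inter> set (take b P)) < c \<and> card (N1 (P ! b) \<inter> set (drop b P)) < c"
  using assms
proof (induction P arbitrary: b)
  case Nil
  then show ?case by simp
next
  case (Cons x P)
  have sp: "spaced P" by (rule spaced_tl[OF Cons.prems(1)])
  \<comment> \<open>Fewer than \<open>c\<close> on each side means at most \<open>2 * c - 2\<close>
    in all. A new vertex in front raises this to at most \<open>2 * c - 1\<close>, still below the
    degree into \<open>S1\<close>.\<close>
  have tot: "card (N1 w \<inter> set P) \<le> 2 * c - 2" if w: "w \<in> set P" "w \<in> S2" for w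
  proof -
    obtain i where i: "i < length P" "P ! i = w" using w(1) by (auto simp: in_set_conv_nth)
    note card_Int_set_split[of "N1 w" P i]
    moreover have "card (N1 w \<inter> set (take i P)) < c \<and> card (N1 w \<inter> set (drop i P)) < c"
      using Cons.IH[OF sp i(1)] w(2) unfolding i(2) by blast
    ultimately show ?thesis by linarith
  qed
  show ?case
  proof (cases b)
    case 0
    then have x: "x \<in> S2" "x \<notin> S1" using Cons.prems disj by auto
    have "card (N1 x \<inter> set (x # P)) < c"
    proof (rule ccontr)
      \<comment> \<open>The shortest prefix with \<open>c\<close> neighbours of \<open>x\<close>
        ends in one of them, and so closes up to a cycle.\<close>
      let ?Q = "\<lambda>f. c \<le> card (N1 x \<inter> set (take f (x # P)))"
      assume "\<not> ?thesis"
      then have ex: "?Q (length (x # P))" by simp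
      define f where "f = (LEAST f. ?Q f)"
      have f: "?Q f" unfolding f_def using ex by (rule LeastI)
      have fle: "f \<le> length (x # P)" unfolding f_def using ex by (rule Least_le)
      have "f \<noteq> 0" using f c by (metis Int_empty_right card.empty le_zero_eq list.set(1) not_numeral_le_zero take0)
      then obtain g where g: "f = Suc g" by (cases f) auto
      have g_lt: "g < length (x # P)" using fle g by simp
      have ng: "card (N1 x \<inter> set (take g (x # P))) < c"
        using not_less_Least[of g ?Q] g unfolding f_def by auto
      have tk: "take f (x # P) = take g (x # P) @ [(x # P) ! g]"
        unfolding g by (rule take_Suc_conv_app_nth[OF g_lt])
      then have st: "set (take f (x # P)) = insert ((x # P) ! g) (set (take g (x # P)))" by simp
      have gN: "(x # P) ! g \<in> N1 x"
      proof (rule ccontr)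
        assume "(x # P) ! g \<notin> N1 x"
        then have "N1 x \<inter> set (take f (x # P)) = N1 x \<inter> set (take g (x # P))" using st by auto
        then show False using f ng by simp
      qed
      have "card (N1 x \<inter> set (take f (x # P))) \<le> Suc (card (N1 x \<inter> set (take g (x # P))))"
        unfolding st by (simp add: card_insert_le_m1 Int_insert_right card_insert_if)
      then have cc: "card (N1 x \<inter> set (take f (x # P))) = c" using f ng by simp
      let ?L = "take f (x # P)"
      have hdL: "hd ?L = x" using g by simp
      have lastL: "last ?L = (x # P) ! g" using tk by simp
      have sub: "set ?L \<subseteq> insert x (set P)" using set_take_subset[of f "x # P"] by simp
      show False
      proof (rule no_theta_at_hd[of ?L])
        show "spaced ?L" using Cons.prems(1) spaced_take by blast
        show "hd ?L \<in> S2" using hdL x by simp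
        show "last ?L \<in> N1 (hd ?L)" using hdL lastL gN by simp
        show "card (N1 (hd ?L) \<inter> set ?L) = c" using hdL cc by simp
      next
        fix w assume w: "w \<in> set ?L" "w \<in> S2"
        show "\<exists>u\<in>S1. u \<notin> set ?L \<and> adj w u"
        proof (cases "w = x")
          case True
          then show ?thesis using off_path_nbr[of x ?L] cc c x by simp
        next
          case False
          then have wP: "w \<in> set P" using w sub by blast
          have "N1 w \<inter> set ?L \<subseteq> N1 w \<inter> set P" using sub x by (auto simp: N1_def)
          then have "card (N1 w \<inter> set ?L) \<le> card (N1 w \<inter> set P)" by (intro card_mono) auto
          then have "card (N1 w \<inter> set ?L) < 2 * c" using tot[OF wP w(2)] c by linarith
          then show ?thesis using off_path_nbr w(2) by blast
        qed
      qed
    qed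
    then show ?thesis using 0 c by simp
  next
    case (Suc b')
    then have b': "b' < length P" "P ! b' \<in> S2" using Cons.prems by auto
    define w where "w = P ! b'"
    have w: "w \<in> S2" "w \<in> set P" "w \<notin> S1" using b' disj by (auto simp: w_def)
    have IH: "card (N1 w \<inter> set (take b' P)) < c" "card (N1 w \<inter> set (drop b' P)) < c"
      using Cons.IH[OF sp b'] by (auto simp: w_def)
    \<comment> \<open>Only the new vertex \<open>x\<close> can complete \<open>c\<close> neighbours
      before \<open>w\<close>; the path from \<open>w\<close> back to \<open>x\<close> would then
      close up to a forbidden cycle.\<close>
    have "card (N1 w \<inter> insert x (set (take b' P))) < c"
    proof (rule ccontr)
      assume big: "\<not> ?thesis"
      have xN: "x \<in> N1 w"
      proof (rule ccontr)
        assume "x \<notin> N1 w"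
        then show False using big IH(1) by simp
      qed
      then have x1: "x \<in> S1" by (simp add: N1_def)
      have cc: "card (N1 w \<inter> insert x (set (take b' P))) = c"
        using big IH(1) xN by (simp add: Int_insert_right card_insert_if split: if_splits)
      let ?L = "rev (take (Suc (Suc b')) (x # P))"
      have tk: "take (Suc b') P = take b' P @ [w]"
        using take_Suc_conv_app_nth[OF b'(1)] by (simp add: w_def)
      have L: "?L = w # rev (take b' P) @ [x]" using tk by simp
      have setL: "set ?L = insert w (insert x (set (take b' P)))" unfolding L by auto
      have subL: "set ?L \<subseteq> insert x (set P)" unfolding setL using w set_take_subset[of b' P] by auto
      show False
      proof (rule no_theta_at_hd[of ?L])
        show "spaced ?L" using Cons.prems(1) spaced_take spaced_rev by blast
        show "hd ?L \<in> S2" unfolding L using w by simp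
        show "last ?L \<in> N1 (hd ?L)" unfolding L using xN by simp
        have "N1 w \<inter> set ?L = N1 w \<inter> insert x (set (take b' P))"
          unfolding setL using w by (auto simp: N1_def)
        moreover have "hd ?L = w" unfolding L by simp
        ultimately show "card (N1 (hd ?L) \<inter> set ?L) = c" using cc by (simp only:)
      next
        fix v assume v: "v \<in> set ?L" "v \<in> S2"
        then have vP: "v \<in> set P" using subL x1 disj by auto
        have "N1 v \<inter> set ?L \<subseteq> insert x (N1 v \<inter> set P)" using subL by auto
        then have "card (N1 v \<inter> set ?L) \<le> card (insert x (N1 v \<inter> set P))" by (intro card_mono) auto
        also have "\<dots> \<le> Suc (card (N1 v \<inter> set P))" by (simp add: card_insert_if)
        finally have "card (N1 v \<inter> set ?L) < 2 * c" using tot[OF vP v(2)] c by linarith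
        then show "\<exists>u\<in>S1. u \<notin> set ?L \<and> adj v u" using off_path_nbr v(2) by blast
      qed
    qed
    then show ?thesis using IH(2) Suc by (simp add: w_def)
  qed
qed

lemma few_on_path:
  assumes "spaced P" "w \<in> set P" "w \<in> S2"
  shows "card (N1 w \<inter> set P) \<le> 2 * c - 2"
proof -
  obtain i where i: "i < length P" "P ! i = w" using assms by (auto simp: in_set_conv_nth)
  note card_Int_set_split[of "N1 w" P i]
  moreover have "card (N1 w \<inter> set (take i P)) < c \<and> card (N1 w \<inter> set (drop i P)) < c"
    using few_before_and_after[OF assms(1) i(1)] assms(3) unfolding i(2) by blast
  ultimately show ?thesis by linarith
qed

text \<open>The neighbour at position \<open>f\<close> closes a cycle of length at least
  \<open>2 * k\<close>, in which any neighbour between positions 1 and \<open>f\<close> gives a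
  chord. The cycle is well placed, as each of its middle vertices has at most
  \<open>2 * c - 2\<close> neighbours in \<open>S1\<close> on it.\<close>

lemma far_nbr_unique:
  assumes P: "spaced P" and f: "adj (P ! 0) (P ! f)" "2 * k \<le> f + 1" "f < length P"
    and j: "adj (P ! 0) (P ! j)" "j < f"
  shows "j \<le> 1"
proof (rule ccontr)
  assume j1: "\<not> ?thesis"
  let ?L = "take (f + 1) P"
  have "theta adj k ?L"
    unfolding theta_def
  proof (intro conjI exI[of _ j])
    show "distinct ?L" "successively adj ?L" using spaced_take[OF P] by (auto simp: spaced_def)
    show "2 * k \<le> length ?L" "2 \<le> j" "j + 2 \<le> length ?L" using f j j1 by auto
    have "last ?L = P ! f" using f by (subst last_conv_nth) auto
    moreover have "hd ?L = P ! 0" using f by (subst hd_conv_nth) auto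
    ultimately show "adj (last ?L) (hd ?L)" using f sym by auto
    show "adj (?L ! 0) (?L ! j)" using j by simp
  qed
  moreover have "set ?L \<subseteq> S1 \<union> S2 \<union> S3" using spaced_take[OF P] by (auto simp: spaced_def)
  moreover have "\<exists>u\<in>S1. u \<notin> set ?L \<and> adj w u" if "w \<in> set ?L" "w \<in> S2" for w
    using off_path_nbr[OF that(2)] few_on_path[OF spaced_take[OF P] that] c by simp
  ultimately show False using no_theta by blast
qed

text \<open>Either all neighbours are among the first \<open>2 * k\<close> vertices, or there is a
  distant one, and then no other beyond position 1.\<close>

lemma few_nbrs_of_hd:
  assumes P: "spaced P"
  shows "card {u \<in> set P. adj (P ! 0) u} \<le> 2 * k"
proof -
  define I where "I = {i. i < length P \<and> P ! i \<in> {u. adj (P ! 0) u}}"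
  have eq: "card {u \<in> set P. adj (P ! 0) u} = card I"
    using card_nth_preimage[of P "{u. adj (P ! 0) u}"] P
    by (simp add: I_def spaced_def Int_def conj_commute)
  show ?thesis
  proof (cases "I \<subseteq> {..<2 * k}")
    case True
    then show ?thesis using eq card_mono[OF _ True] by simp
  next
    case False
    then obtain f where f: "f \<in> I" "2 * k \<le> f" by force
    have "I \<subseteq> {0, 1, f}"
    proof
      fix j assume j: "j \<in> I"
      consider "j < f" | "j = f" | "f < j" by linarith
      then show "j \<in> {0, 1, f}"
      proof cases
        case 1
        then have "j \<le> 1" using far_nbr_unique[OF P, of f j] f j by (auto simp: I_def)
        then show ?thesis by auto
      next
        case 3
        then have "f \<le> 1" using far_nbr_unique[OF P, of j f] f j by (auto simp: I_def)
        then show ?thesis using f k3 by auto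
      qed simp
    qed
    then have "card I \<le> card {0, 1, f}" by (intro card_mono) auto
    also have "\<dots> \<le> 3" by (simp add: card_insert_if)
    finally show ?thesis using eq k3 by linarith
  qed
qed

section \<open>Extending a path through the last two layers\<close>

text \<open>\<open>Q\<close> extends \<open>P\<close> by \<open>2j - 1\<close> vertices alternating between \<open>S2\<close> and \<open>S3\<close>; its end is its head.\<close>

definition reaches :: "'a list \<Rightarrow> nat \<Rightarrow> 'a list \<Rightarrow> bool" where
  "reaches P j Q \<longleftrightarrow> Q \<noteq> [] \<and> hd Q \<in> S2 \<and> spaced (Q @ P) \<and> set Q \<subseteq> S2 \<union> S3 \<and>
     length Q + 1 = 2 * j \<and> card (set Q \<inter> S2) \<le> j"

definition reached :: "'a list \<Rightarrow> nat \<Rightarrow> 'a set" where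
  "reached P j = hd ` {Q. reaches P j Q}"

lemma reached_subset: "reached P j \<subseteq> S2"
  by (auto simp: reached_def reaches_def)

lemma finite_reached [simp]: "finite (reached P j)"
  using reached_subset fin(2) finite_subset by blast

lemma card_reached_1:
  assumes P: "spaced P" "P \<noteq> []" "hd P \<in> S1"
  shows "(8 * k) ^ (k + 2) \<le> card (reached P 1) + 2 * k"
proof -
  have "{u \<in> S2. adj (hd P) u} \<subseteq> reached P 1 \<union> {u \<in> set P. adj (P ! 0) u}"
  proof
    fix u assume u: "u \<in> {u \<in> S2. adj (hd P) u}"
    show "u \<in> reached P 1 \<union> {u \<in> set P. adj (P ! 0) u}"
    proof (cases "u \<in> set P")
      case True
      then show ?thesis using u P(2) by (simp add: hd_conv_nth)
    next
      case False
      have "spaced (u # P)" using spaced_Cons[OF P(1,2) False] u sym by auto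
      then have "reaches P 1 [u]" using u by (simp add: reaches_def)
      then show ?thesis by (force simp: reached_def)
    qed
  qed
  then have "card {u \<in> S2. adj (hd P) u} \<le> card (reached P 1 \<union> {u \<in> set P. adj (P ! 0) u})"
    by (intro card_mono) auto
  also have "\<dots> \<le> card (reached P 1) + card {u \<in> set P. adj (P ! 0) u}" by (rule card_Un_le)
  finally show ?thesis using few_nbrs_of_hd[OF P(1)] deg12[OF P(3)] by linarith
qed

text \<open>A cycle that avoids \<open>S1\<close> is automatically well placed.\<close>

lemma no_theta_two_layers:
  assumes "theta adj k R" "set R \<subseteq> S2 \<union> S3"
  shows False
proof (rule no_theta[OF assms(1)])
  show "set R \<subseteq> S1 \<union> S2 \<union> S3" using assms(2) by blast
  show "\<exists>u\<in>S1. u \<notin> set R \<and> adj w u" if "w \<in> set R" "w \<in> S2" for w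
  proof -
    have "N1 w \<inter> set R = {}" using assms(2) disj by (auto simp: N1_def)
    then show ?thesis using off_path_nbr[OF that(2), of R] c by simp
  qed
qed

text \<open>The set \<open>X\<close> of new neighbours in \<open>S3\<close> is large, since
  \<open>F\<close> has almost \<open>card U * m / 2\<close> edges but at most \<open>k - 1\<close>
  per vertex. All of \<open>X\<close> outside a small set \<open>NW\<close> extends to
  \<open>U'\<close>, and each vertex of \<open>U'\<close> accounts for at most \<open>m\<close> of
  its elements.\<close>

lemma card_reached_step:
  assumes P: "spaced P" and j: "1 \<le> j" "j < D" and big: "16 * k\<^sup>2 \<le> card (reached P j)"
  shows "card (reached P j) \<le> 4 * k * card (reached P (Suc j))"
proof -
  define U where "U = reached P j"
  define U' where "U' = reached P (Suc j)"
  have "\<exists>Q. reaches P j Q \<and> hd Q = y" if "y \<in> U" for y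
    using that by (auto simp: U_def reached_def)
  then obtain q where q: "\<And>y. y \<in> U \<Longrightarrow> reaches P j (q y)" "\<And>y. y \<in> U \<Longrightarrow> hd (q y) = y"
    by metis
  have US: "U \<subseteq> S2" and finU: "finite U" using reached_subset by (auto simp: U_def)
  define nx where "nx y = {x \<in> S3. adj y x} - set (q y @ P)" for y
  define F where "F = Sigma U nx"
  define X where "X = snd ` F"
  have fin_nx: "finite (nx y)" for y using fin by (simp add: nx_def)
  have nx_ge: "m \<le> 2 * card (nx y) + 4 * k" if y: "y \<in> U" for y
  proof -
    have sp: "spaced (q y @ P)" and ne: "q y \<noteq> []" using q(1)[OF y] by (auto simp: reaches_def)
    have h: "(q y @ P) ! 0 = y" using q(2)[OF y] ne by (simp add: nth_append hd_conv_nth)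
    have "{x \<in> S3. adj y x} \<subseteq> nx y \<union> {u \<in> set (q y @ P). adj y u}" by (auto simp: nx_def)
    then have "card {x \<in> S3. adj y x} \<le> card (nx y \<union> {u \<in> set (q y @ P). adj y u})"
      using fin_nx by (intro card_mono) auto
    also have "\<dots> \<le> card (nx y) + card {u \<in> set (q y @ P). adj y u}" by (rule card_Un_le)
    also have "\<dots> \<le> card (nx y) + 2 * k" using few_nbrs_of_hd[OF sp] unfolding h by simp
    finally show ?thesis using deg23[of y] US y by fastforce
  qed
  have "card U * m \<le> (\<Sum>y\<in>U. 2 * card (nx y) + 4 * k)"
    using sum_bounded_below[of U m "\<lambda>y. 2 * card (nx y) + 4 * k"] nx_ge by simp
  also have "\<dots> = 2 * card F + 4 * k * card U"
    using finU fin_nx by (simp add: F_def card_SigmaI sum.distrib sum_distrib_left)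
  finally have F1: "card U * m \<le> 2 * card F + 4 * k * card U" .
  have XS: "X \<subseteq> S3" by (auto simp: X_def F_def nx_def)
  have finX: "finite X" using XS fin finite_subset by blast
  have FX: "F \<subseteq> U \<times> X" by (force simp: F_def X_def)
  have F2: "card F \<le> (k - 1) * (card U + card X)"
  proof (rule ccontr)
    assume dense: "\<not> ?thesis"
    have "U \<inter> X = {}" using US XS disj by blast
    from theta_if_dense[OF finU finX this FX k3]
    obtain R where R: "theta (\<lambda>u v. (u, v) \<in> F \<or> (v, u) \<in> F) k R" "set R \<subseteq> U \<union> X"
      using dense by auto
    have "theta adj k R" by (rule theta_mono[OF R(1)]) (use sym in \<open>auto simp: F_def nx_def\<close>)
    then show False using no_theta_two_layers[of R] R(2) US XS by blast
  qed
  \<comment> \<open>Discarding the neighbours of the first \<open>2 * k\<close> vertices of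
    \<open>P\<close> costs at most \<open>2 * k * m\<close> elements of \<open>X\<close>; any
    neighbour in \<open>S2\<close> that the others have on \<open>P\<close> is far away.\<close>
  define W where "W = S2 \<inter> set (take (2 * k) P)"
  define NW where "NW = (\<Union>w\<in>W. {x \<in> S3. adj w x})"
  have "card W \<le> card (set (take (2 * k) P))" unfolding W_def by (intro card_mono) auto
  also have "\<dots> \<le> 2 * k" by (rule order_trans[OF card_length]) simp
  finally have cW: "card W \<le> 2 * k" .
  have "card NW \<le> (\<Sum>w\<in>W. card {x \<in> S3. adj w x})" unfolding NW_def by (rule card_UN_le) (simp add: W_def)
  also have "\<dots> \<le> card W * m"
    using sum_bounded_above[of W "\<lambda>w. card {x \<in> S3. adj w x}" m] deg23_le by (simp add: W_def)
  finally have cNW: "card NW \<le> 2 * k * m" using cW by (meson mult_le_mono1 order_trans)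
  have finNW: "finite NW" using fin by (auto simp: NW_def W_def)
  have ext: "\<exists>y'\<in>U'. adj y' x" if x: "x \<in> X - NW" for x
  proof -
    obtain y where y: "y \<in> U" "x \<in> S3" "adj y x" "x \<notin> set (q y @ P)"
      using x by (auto simp: X_def F_def nx_def)
    define Q where "Q = q y"
    have Q: "Q \<noteq> []" "spaced (Q @ P)" "set Q \<subseteq> S2 \<union> S3" "length Q + 1 = 2 * j" "card (set Q \<inter> S2) \<le> j"
      using q(1)[OF y(1)] by (auto simp: reaches_def Q_def)
    have hQ: "hd Q = y" using q(2)[OF y(1)] by (simp add: Q_def)
    have sp: "spaced (x # Q @ P)"
      using spaced_Cons[OF Q(2), of x] Q(1) y hQ sym by (auto simp: Q_def)
    define M where "M = {u \<in> S2. adj x u}"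
    have cM: "D \<le> card M" using deg32[OF y(2)] by (simp add: M_def)
    \<comment> \<open>A neighbour of \<open>x\<close> on \<open>P\<close> is far from \<open>x\<close> since \<open>x \<notin> NW\<close>, and then \<open>x\<close> has at most one other
      neighbour on the path; otherwise its neighbours on the path are among the at most \<open>j < D\<close> in \<open>Q\<close>.\<close>
    have "\<not> M \<subseteq> set (Q @ P)"
    proof
      assume sub: "M \<subseteq> set (Q @ P)"
      show False
      proof (cases "M \<inter> set P = {}")
        case True
        then have "M \<subseteq> set Q \<inter> S2" using sub by (auto simp: M_def)
        then have "card M \<le> card (set Q \<inter> S2)" by (intro card_mono) auto
        then show False using Q(5) cM j by linarith
      next
        case False
        then obtain u where u: "u \<in> M" "u \<in> set P" by blast
        then obtain i where i: "i < length P" "P ! i = u" by (auto simp: in_set_conv_nth)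
        have "u \<notin> set (take (2 * k) P)"
          using u x sym y(2) by (auto simp: M_def NW_def W_def)
        then have "2 * k \<le> i" using i by (metis in_set_conv_nth length_take min_less_iff_conj not_le nth_take)
        define f where "f = Suc (length Q + i)"
        have f: "(x # Q @ P) ! f = u" "f < length (x # Q @ P)" "2 * k \<le> f"
          using i \<open>2 * k \<le> i\<close> by (auto simp: f_def)
        have fadj: "adj ((x # Q @ P) ! 0) ((x # Q @ P) ! f)" using f(1) u(1) by (simp add: M_def)
        have "M \<subseteq> {(x # Q @ P) ! 1, (x # Q @ P) ! f}"
        proof
          fix v assume v: "v \<in> M"
          then have "v \<in> set (x # Q @ P)" using sub by auto
          then obtain i' where i': "i' < length (x # Q @ P)" "(x # Q @ P) ! i' = v"
            unfolding in_set_conv_nth by blast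
          have vadj: "adj ((x # Q @ P) ! 0) ((x # Q @ P) ! i')" using v unfolding i'(2) by (simp add: M_def)
          have "i' \<noteq> 0" using i' v y(2) disj by (auto simp: M_def)
          consider "i' < f" | "i' = f" | "f < i'" by linarith
          then show "v \<in> {(x # Q @ P) ! 1, (x # Q @ P) ! f}"
          proof cases
            case 1
            have "i' \<le> 1" using far_nbr_unique[OF sp fadj _ f(2) vadj 1] f(3) by simp
            then have "i' = 1" using \<open>i' \<noteq> 0\<close> by simp
            then show ?thesis using i'(2) by blast
          next
            case 2
            then show ?thesis using i'(2) by blast
          next
            case 3
            have "f \<le> 1" using far_nbr_unique[OF sp vadj _ i'(1) fadj 3] 3 f(3) by simp
            then show ?thesis using f(3) k3 by simp
          qed
        qed
        then have "card M \<le> card {(x # Q @ P) ! 1, (x # Q @ P) ! f}" by (intro card_mono) auto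
        also have "\<dots> \<le> 2" by (simp add: card_insert_if)
        finally show False using cM D by linarith
      qed
    qed
    then obtain y' where y': "y' \<in> S2" "adj x y'" "y' \<notin> set (Q @ P)" by (auto simp: M_def)
    have "y' \<noteq> x" using y'(1) y(2) disj by blast
    then have "spaced (y' # x # Q @ P)"
      using spaced_Cons[OF sp, of y'] y' sym by auto
    moreover have "card (set (y' # x # Q) \<inter> S2) \<le> Suc j"
    proof -
      have "set (y' # x # Q) \<inter> S2 \<subseteq> insert y' (set Q \<inter> S2)" using y(2) disj by auto
      then have "card (set (y' # x # Q) \<inter> S2) \<le> card (insert y' (set Q \<inter> S2))" by (intro card_mono) auto
      also have "\<dots> \<le> Suc (card (set Q \<inter> S2))" by (simp add: card_insert_if)
      finally show ?thesis using Q(5) by simp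
    qed
    ultimately have "reaches P (Suc j) (y' # x # Q)"
      using Q y'(1) y(2) by (auto simp: reaches_def)
    then have "y' \<in> U'" by (force simp: U'_def reached_def)
    then show ?thesis using y' sym by blast
  qed
  have "X - NW \<subseteq> (\<Union>y\<in>U'. {x \<in> S3. adj y x})" using ext XS by blast
  then have "card (X - NW) \<le> card (\<Union>y\<in>U'. {x \<in> S3. adj y x})"
    using fin by (intro card_mono) (auto simp: U'_def)
  also have "\<dots> \<le> (\<Sum>y\<in>U'. card {x \<in> S3. adj y x})" by (rule card_UN_le) (simp add: U'_def)
  also have "\<dots> \<le> card U' * m"
    using sum_bounded_above[of U' "\<lambda>w. card {x \<in> S3. adj w x}" m] deg23_le reached_subset
    by (auto simp: U'_def)
  finally have c1: "card (X - NW) \<le> card U' * m" .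
  have "card X \<le> card (X - NW) + card NW"
    using card_Un_le[of "X - NW" NW] card_mono[of "X - NW \<union> NW" X] finX finNW by auto
  then have X3: "card X \<le> card U' * m + 2 * k * m" using c1 cNW by linarith
  have "(k - 1) * (card U + card X) \<le> k * (card U + (card U' * m + 2 * k * m))"
    using X3 by (intro mult_le_mono) auto
  then have "card U * m \<le> 2 * (k * (card U + (card U' * m + 2 * k * m))) + 4 * k * card U"
    using F1 F2 by linarith
  then have "card U * m \<le> 6 * k * card U + 2 * k * card U' * m + 4 * k * k * m"
    by (simp add: algebra_simps)
  \<comment> \<open>This bound and the next make the two summands without \<open>U'\<close> at most
    a quarter of \<open>card U * m\<close> each, whence the factor \<open>4 * k\<close>.\<close>
  moreover have "24 * k * card U \<le> card U * m" using m by (simp add: mult.commute)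
  moreover have "16 * k * k * m \<le> card U * m"
    using big by (intro mult_le_mono1) (simp add: U_def power2_eq_square)
  ultimately have "card U * m \<le> (4 * k * card U') * m" by linarith
  then show ?thesis using m k3 by (simp add: U_def U'_def)
qed

text \<open>Reaching \<open>reached P D\<close> appends \<open>2 * D - 1\<close> vertices off
  \<open>S1\<close>. The new end has at least \<open>2 * c\<close> neighbours in \<open>S1\<close>,
  at most \<open>2 * c - 2\<close> of them on the path, so a fresh one can follow, exactly
  \<open>2 * D\<close> steps after the previous visit.\<close>

lemma extend_by_segment:
  assumes P: "spaced P" "P \<noteq> []" "hd P \<in> S1"
  shows "\<exists>P'. spaced P' \<and> P' \<noteq> [] \<and> hd P' \<in> S1 \<and> length P < length P'"
proof -
  \<comment> \<open>Each of fewer than \<open>k\<close> steps loses a factor \<open>4 * k\<close>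
    and has to start from \<open>16 * k\<^sup>2\<close> vertices. The bound in \<open>deg12\<close>
    is at least \<open>4 * B\<close>, which leaves \<open>B\<close> even after removing the at most
    \<open>2 * k\<close> neighbours on \<open>P\<close>.\<close>
  define B where "B = 16 * k\<^sup>2 * (4 * k) ^ k"
  have B_le: "B \<le> card (reached P (Suc i)) * (4 * k) ^ i" if "i < D" for i
    using that
  proof (induction i)
    case 0
    have "(8 * k) ^ (k + 2) = 64 * k\<^sup>2 * (8 * k) ^ k" by (simp add: power_add power2_eq_square)
    also have "\<dots> \<ge> 64 * k\<^sup>2 * (4 * k) ^ k" by (intro mult_left_mono power_mono) auto
    finally have 1: "4 * B \<le> (8 * k) ^ (k + 2)" by (simp add: B_def)
    have "2 * k \<le> 16 * k\<^sup>2" using k3 by (simp add: power2_eq_square)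
    also have "\<dots> \<le> B" unfolding B_def using k3 by simp
    finally have "4 * B \<le> card (reached P 1) + B" using 1 card_reached_1[OF P] by linarith
    then show ?case by simp
  next
    case (Suc i)
    then have IH: "B \<le> card (reached P (Suc i)) * (4 * k) ^ i" by simp
    have "16 * k\<^sup>2 * (4 * k) ^ i \<le> B"
      unfolding B_def using Suc.prems D k3 by (intro mult_left_mono power_increasing) auto
    then have "16 * k\<^sup>2 * (4 * k) ^ i \<le> card (reached P (Suc i)) * (4 * k) ^ i" using IH by linarith
    then have "16 * k\<^sup>2 \<le> card (reached P (Suc i))" using k3 by simp
    then have "card (reached P (Suc i)) \<le> 4 * k * card (reached P (Suc (Suc i)))"
      using card_reached_step[OF P(1), of "Suc i"] Suc.prems by simp
    then have "card (reached P (Suc i)) * (4 * k) ^ i \<le> 4 * k * card (reached P (Suc (Suc i))) * (4 * k) ^ i"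
      by (intro mult_le_mono1)
    also have "\<dots> = card (reached P (Suc (Suc i))) * (4 * k) ^ Suc i"
      by (simp only: power_Suc mult_ac)
    finally show ?case using IH by linarith
  qed
  have "0 < B" using k3 by (simp add: B_def)
  moreover have "B \<le> card (reached P D) * (4 * k) ^ (D - 1)" using B_le[of "D - 1"] D by simp
  ultimately have "card (reached P D) \<noteq> 0" by (metis mult_is_0 not_le)
  then have "reached P D \<noteq> {}" by force
  then obtain Q where "reaches P D Q" by (auto simp: reached_def)
  then have Q: "Q \<noteq> []" "hd Q \<in> S2" "spaced (Q @ P)" "set Q \<subseteq> S2 \<union> S3" "length Q + 1 = 2 * D"
    by (auto simp: reaches_def)
  have "card (N1 (hd Q) \<inter> set (Q @ P)) < 2 * c"
    using few_on_path[OF Q(3), of "hd Q"] Q(1,2) c by (simp add: less_le_trans)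
  then obtain z where z: "z \<in> S1" "z \<notin> set (Q @ P)" "adj (hd Q) z"
    using off_path_nbr[OF Q(2)] by blast
  have "spaced (z # Q @ P)"
    unfolding spaced_def
  proof (intro conjI allI impI)
    fix a b assume ab: "a < b" "b < length (z # Q @ P)" "(z # Q @ P) ! a \<in> S1" "(z # Q @ P) ! b \<in> S1"
    then obtain b' where b': "b = Suc b'" by (cases b) auto
    show "a + 2 * D \<le> b"
    proof (cases a)
      case 0
      have "\<not> b' < length Q"
      proof
        assume "b' < length Q"
        then have "Q ! b' \<in> S1" "Q ! b' \<in> set Q" using ab b' by (auto simp: nth_append)
        then show False using Q(4) disj by blast
      qed
      then show ?thesis using 0 b' Q(5) by simp
    next
      case (Suc a')
      then have "a' < b'" "b' < length (Q @ P)" "(Q @ P) ! a' \<in> S1" "(Q @ P) ! b' \<in> S1"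
        using ab b' by auto
      then have "a' + 2 * D \<le> b'" using Q(3) unfolding spaced_def by blast
      then show ?thesis using Suc b' by simp
    qed
  qed (use z sym Q in \<open>auto simp: spaced_def successively_Cons\<close>)
  then show ?thesis using z by (intro exI[of _ "z # Q @ P"]) auto
qed

lemma S1_empty: "S1 = {}"
proof (rule ccontr)
  assume "S1 \<noteq> {}"
  then obtain v where v: "v \<in> S1" by blast
  have "\<exists>P. spaced P \<and> P \<noteq> [] \<and> hd P \<in> S1 \<and> n \<le> length P" for n
  proof (induction n)
    case 0
    have "spaced [v]" using v by (simp add: spaced_def)
    then show ?case using v by (intro exI[of _ "[v]"]) auto
  next
    case (Suc n)
    then show ?case using extend_by_segment by (meson Suc_leI le_less_trans)
  qed
  then obtain P where P: "spaced P" "Suc (card (S1 \<union> S2 \<union> S3)) \<le> length P" by blast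
  have "length P = card (set P)" using P(1) by (simp add: spaced_def distinct_card)
  also have "\<dots> \<le> card (S1 \<union> S2 \<union> S3)" using P(1) fin by (intro card_mono) (auto simp: spaced_def)
  finally show False using P(2) by simp
qed

end

section \<open>Pruning three layers to prescribed degrees\<close>

definition arcs :: "('a \<Rightarrow> 'a set) \<Rightarrow> 'a set \<Rightarrow> 'a set \<Rightarrow> ('a \<times> 'a) set" where
  "arcs e V S = Sigma (S \<inter> V) (\<lambda>v. e v \<inter> S)"

lemma card_arcs_remove_target:
  assumes "finite S" "x \<notin> V"
  shows "card (arcs e V S) \<le> card (arcs e V (S - {x})) + card {v \<in> S \<inter> V. x \<in> e v}"
proof -
  have "arcs e V S \<subseteq> arcs e V (S - {x}) \<union> (\<lambda>v. (v, x)) ` {v \<in> S \<inter> V. x \<in> e v}"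
    using assms(2) by (auto simp: arcs_def)
  then have "card (arcs e V S) \<le> card (arcs e V (S - {x}) \<union> (\<lambda>v. (v, x)) ` {v \<in> S \<inter> V. x \<in> e v})"
    using assms(1) by (intro card_mono) (auto simp: arcs_def)
  also have "\<dots> \<le> card (arcs e V (S - {x})) + card {v \<in> S \<inter> V. x \<in> e v}"
    by (rule order_trans[OF card_Un_le add_left_mono[OF card_image_le]]) (use assms(1) in simp)
  finally show ?thesis .
qed

lemma card_arcs_remove_source:
  assumes "finite S" "\<And>v. v \<in> V \<Longrightarrow> x \<notin> e v"
  shows "card (arcs e V S) \<le> card (arcs e V (S - {x})) + card (e x \<inter> S)"
proof -
  have "arcs e V S \<subseteq> arcs e V (S - {x}) \<union> Pair x ` (e x \<inter> S)"
    using assms(2) by (auto simp: arcs_def)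
  then have "card (arcs e V S) \<le> card (arcs e V (S - {x}) \<union> Pair x ` (e x \<inter> S))"
    using assms(1) by (intro card_mono) (auto simp: arcs_def)
  also have "\<dots> \<le> card (arcs e V (S - {x})) + card (e x \<inter> S)"
    by (rule order_trans[OF card_Un_le add_left_mono[OF card_image_le]]) (use assms(1) in simp)
  finally show ?thesis .
qed

text \<open>The claim amounts to \<open>\<phi> V \<le> 0\<close>, as each middle vertex contributes
  \<open>(2 * c + 1) * m + 2 * m - (2 * c + 2) * m = m\<close>. A maximiser \<open>S\<close> of
  \<open>\<phi>\<close> satisfies the conditions of \<open>trilayer\<close>, so its first layer is
  empty, hence so is its middle layer, and \<open>\<phi> S\<close> is at most 0.\<close>

lemma middle_layer_bound:
  fixes V1 V2 V3 :: "'a set" and k c D m :: nat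
  assumes sym: "\<And>u v. adj u v \<Longrightarrow> adj v u"
    and fin: "finite V1" "finite V2" "finite V3"
    and disj: "V1 \<inter> V2 = {}" "V1 \<inter> V3 = {}" "V2 \<inter> V3 = {}"
    and c: "3 \<le> c" and D: "3 \<le> D" "D \<le> k" and cD: "k - 1 \<le> (c - 1) * D" and m: "24 * k \<le> m"
    and deg1: "\<And>v. v \<in> V2 \<Longrightarrow> 2 * c + 1 \<le> card {u \<in> V1. adj v u}"
    and deg3: "\<And>v. v \<in> V2 \<Longrightarrow> m \<le> card {u \<in> V3. adj v u}"
    and no_theta: "\<And>R. theta adj k R \<Longrightarrow> set R \<subseteq> V1 \<union> V2 \<union> V3 \<Longrightarrow>
      (\<And>w. w \<in> set R \<Longrightarrow> w \<in> V2 \<Longrightarrow> \<exists>u\<in>V1. u \<notin> set R \<and> adj w u) \<Longrightarrow> False"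
  shows "m * card V2 \<le> m * (8 * k) ^ (k + 2) * card V1 + 2 * D * card V3"
proof -
  have "\<exists>T. T \<subseteq> {u \<in> V1. adj v u} \<and> card T = 2 * c + 1" if "v \<in> V2" for v
    using obtain_subset_with_card_n[OF deg1[OF that]] by blast
  then obtain e1 where e1: "\<And>v. v \<in> V2 \<Longrightarrow> e1 v \<subseteq> {u \<in> V1. adj v u}" "\<And>v. v \<in> V2 \<Longrightarrow> card (e1 v) = 2 * c + 1"
    by metis
  have "\<exists>T. T \<subseteq> {u \<in> V3. adj v u} \<and> card T = m" if "v \<in> V2" for v
    using obtain_subset_with_card_n[OF deg3[OF that]] by blast
  then obtain e3 where e3: "\<And>v. v \<in> V2 \<Longrightarrow> e3 v \<subseteq> {u \<in> V3. adj v u}" "\<And>v. v \<in> V2 \<Longrightarrow> card (e3 v) = m"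
    by metis
  define V where "V = V1 \<union> V2 \<union> V3"
  define A where "A = (8 * k) ^ (k + 2)"
  \<comment> \<open>Removing a vertex from a maximiser of \<open>\<phi>\<close> gains nothing, which yields the degree conditions of
    \<open>trilayer\<close>. The truncation to \<open>2c + 1\<close> and \<open>m\<close> arcs makes a middle vertex keep \<open>2c\<close> arcs
    of the first kind and \<open>m / 2\<close> of the second.\<close>
  define \<phi> where "\<phi> S = int m * (int (card (arcs e1 V2 S)) - int A * int (card (S \<inter> V1)))
      + 2 * (int (card (arcs e3 V2 S)) - int D * int (card (S \<inter> V3)))
      - (2 * int c + 2) * int m * int (card (S \<inter> V2))" for S
  have "finite (Pow V)" "Pow V \<noteq> {}" using fin by (auto simp: V_def)
  then obtain S where "S \<in> Pow V" "\<And>T. T \<in> Pow V \<Longrightarrow> \<phi> T \<le> \<phi> S"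
    using finite_has_maximizer[of "Pow V" \<phi>] by blast
  then have S: "S \<subseteq> V" "\<And>T. T \<subseteq> V \<Longrightarrow> \<phi> T \<le> \<phi> S" by auto
  have finS: "finite S" using S(1) fin by (auto simp: V_def intro: finite_subset)
  have m0: "m > 0" using m D by simp
  have rem: "\<phi> (S - {x}) \<le> \<phi> S" for x using S by blast
  have out: "card ((S - {x}) \<inter> T) = card (S \<inter> T)" if "x \<notin> T" for x T
    using that by (intro arg_cong[of _ _ card]) auto
  have inn: "int (card (S \<inter> T)) = int (card ((S - {x}) \<inter> T)) + 1" if "x \<in> S" "x \<in> T" for x T
  proof -
    have "(S - {x}) \<inter> T = (S \<inter> T) - {x}" by blast
    moreover have "card (S \<inter> T) = Suc (card ((S \<inter> T) - {x}))"
      using card.remove[of "S \<inter> T" x] that finS by simp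
    ultimately show ?thesis by simp
  qed
  have d1: "A \<le> card {v \<in> S \<inter> V2. x \<in> e1 v}" if x: "x \<in> S \<inter> V1" for x
  proof -
    have nx: "x \<notin> V2" "x \<notin> V3" using x disj by auto
    have "{v \<in> S \<inter> V2. x \<in> e3 v} = {}" using e3(1) nx by blast
    then have "card (arcs e3 V2 S) \<le> card (arcs e3 V2 (S - {x}))"
      using card_arcs_remove_target[OF finS nx(1), of e3] by (simp only: card.empty add_0_right)
    moreover have "int m * int (card (arcs e1 V2 S))
        \<le> int m * (int (card (arcs e1 V2 (S - {x}))) + int (card {v \<in> S \<inter> V2. x \<in> e1 v}))"
      using card_arcs_remove_target[OF finS nx(1), of e1] by (intro mult_left_mono) auto
    ultimately have "int m * int A \<le> int m * int (card {v \<in> S \<inter> V2. x \<in> e1 v})"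
      using rem[of x] x out[OF nx(1)] out[OF nx(2)] inn[of x V1] by (simp add: \<phi>_def algebra_simps)
    then show ?thesis using m0 by simp
  qed
  have d3: "D \<le> card {v \<in> S \<inter> V2. x \<in> e3 v}" if x: "x \<in> S \<inter> V3" for x
  proof -
    have nx: "x \<notin> V2" "x \<notin> V1" using x disj by auto
    have "{v \<in> S \<inter> V2. x \<in> e1 v} = {}" using e1(1) nx by blast
    then have "card (arcs e1 V2 S) \<le> card (arcs e1 V2 (S - {x}))"
      using card_arcs_remove_target[OF finS nx(1), of e1] by (simp only: card.empty add_0_right)
    then have "int m * int (card (arcs e1 V2 S)) \<le> int m * int (card (arcs e1 V2 (S - {x})))"
      by (intro mult_left_mono) auto
    moreover note card_arcs_remove_target[OF finS nx(1), of e3]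
    ultimately show ?thesis
      using rem[of x] x out[OF nx(1)] out[OF nx(2)] inn[of x V3] by (simp add: \<phi>_def algebra_simps)
  qed
  have d2: "2 * c \<le> card (e1 x \<inter> S) \<and> m \<le> 2 * card (e3 x \<inter> S) \<and> card (e3 x \<inter> S) \<le> m"
    if x: "x \<in> S \<inter> V2" for x
  proof -
    have nx: "x \<notin> V1" "x \<notin> V3" using x disj by auto
    have fe: "finite (e1 x)" "finite (e3 x)"
      using e1(1)[of x] e3(1)[of x] x fin by (auto intro: finite_subset)
    have le1: "card (e1 x \<inter> S) \<le> 2 * c + 1" using e1(2)[of x] x card_mono[OF fe(1), of "e1 x \<inter> S"] by auto
    have le3: "card (e3 x \<inter> S) \<le> m" using e3(2)[of x] x card_mono[OF fe(2), of "e3 x \<inter> S"] by auto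
    have "card (arcs e1 V2 S) \<le> card (arcs e1 V2 (S - {x})) + card (e1 x \<inter> S)"
      by (rule card_arcs_remove_source[OF finS]) (use e1(1) nx in blast)
    then have "int m * int (card (arcs e1 V2 S))
        \<le> int m * (int (card (arcs e1 V2 (S - {x}))) + int (card (e1 x \<inter> S)))"
      by (intro mult_left_mono) auto
    moreover have "card (arcs e3 V2 S) \<le> card (arcs e3 V2 (S - {x})) + card (e3 x \<inter> S)"
      by (rule card_arcs_remove_source[OF finS]) (use e3(1) nx in blast)
    \<comment> \<open>The right side is at most \<open>(2 * c + 1) * m + 2 * m\<close>, only
      \<open>m\<close> more than required: at most one arc of the first kind and half of the second
      kind can be missing.\<close>
    ultimately have *: "(2 * int c + 2) * int m \<le> int m * int (card (e1 x \<inter> S)) + 2 * int (card (e3 x \<inter> S))"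
      using rem[of x] x out[OF nx(1)] out[OF nx(2)] inn[of x V2] by (simp add: \<phi>_def algebra_simps)
    have "int m * (2 * int c) \<le> int m * int (card (e1 x \<inter> S))"
      using * le3 by (simp add: algebra_simps)
    then have "2 * c \<le> card (e1 x \<inter> S)" using m0 by simp
    moreover have "int m * int (card (e1 x \<inter> S)) \<le> int m * (2 * int c + 1)"
      using le1 by (intro mult_left_mono) auto
    then have "m \<le> 2 * card (e3 x \<inter> S)" using * by (simp add: algebra_simps)
    ultimately show ?thesis using le3 by blast
  qed
  \<comment> \<open>Keeping only the selected arcs gives middle vertices at most \<open>m\<close>
    neighbours in the third layer, as \<open>trilayer\<close> demands.\<close>
  define adj' where "adj' u v \<longleftrightarrow> u \<in> V2 \<and> v \<in> e1 u \<union> e3 u \<or> v \<in> V2 \<and> u \<in> e1 v \<union> e3 v" for u v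
  have adj': "adj u v" if "adj' u v" for u v
    using that e1(1) e3(1) sym unfolding adj'_def by blast
  have nb1: "{u \<in> S \<inter> V1. adj' v u} = e1 v \<inter> S" if "v \<in> S \<inter> V2" for v
    using that e1(1)[of v] e3(1)[of v] disj by (auto simp: adj'_def)
  have nb3: "{u \<in> S \<inter> V3. adj' v u} = e3 v \<inter> S" if "v \<in> S \<inter> V2" for v
    using that e1(1)[of v] e3(1)[of v] disj by (auto simp: adj'_def)
  have nb12: "{u \<in> S \<inter> V2. adj' v u} = {u \<in> S \<inter> V2. v \<in> e1 u}" if "v \<in> S \<inter> V1" for v
    using that e3(1) disj by (auto simp: adj'_def)
  have nb32: "{u \<in> S \<inter> V2. adj' v u} = {u \<in> S \<inter> V2. v \<in> e3 u}" if "v \<in> S \<inter> V3" for v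
    using that e1(1) disj by (auto simp: adj'_def)
  interpret T: trilayer adj' "S \<inter> V1" "S \<inter> V2" "S \<inter> V3" k c D m
  proof
    show "adj' v u" if "adj' u v" for u v using that by (auto simp: adj'_def)
    show "finite (S \<inter> V1)" "finite (S \<inter> V2)" "finite (S \<inter> V3)" using finS by auto
    show "(S \<inter> V1) \<inter> (S \<inter> V2) = {}" "(S \<inter> V1) \<inter> (S \<inter> V3) = {}" "(S \<inter> V2) \<inter> (S \<inter> V3) = {}"
      using disj by auto
    show "(8 * k) ^ (k + 2) \<le> card {u \<in> S \<inter> V2. adj' v u}" if "v \<in> S \<inter> V1" for v
      using d1[OF that] unfolding nb12[OF that] A_def .
    show "2 * c \<le> card {u \<in> S \<inter> V1. adj' v u}" if "v \<in> S \<inter> V2" for v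
      using d2[OF that] unfolding nb1[OF that] by blast
    show "m \<le> 2 * card {u \<in> S \<inter> V3. adj' v u}" if "v \<in> S \<inter> V2" for v
      using d2[OF that] unfolding nb3[OF that] by blast
    show "card {u \<in> S \<inter> V3. adj' v u} \<le> m" if "v \<in> S \<inter> V2" for v
      using d2[OF that] unfolding nb3[OF that] by blast
    show "D \<le> card {u \<in> S \<inter> V2. adj' v u}" if "v \<in> S \<inter> V3" for v
      using d3[OF that] unfolding nb32[OF that] .
  next
    fix R assume R: "theta adj' k R" "set R \<subseteq> S \<inter> V1 \<union> S \<inter> V2 \<union> S \<inter> V3"
      "\<And>w. w \<in> set R \<Longrightarrow> w \<in> S \<inter> V2 \<Longrightarrow> \<exists>u\<in>S \<inter> V1. u \<notin> set R \<and> adj' w u"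
    have "theta adj k R" by (rule theta_mono[OF R(1) adj'])
    then show False
      by (rule no_theta) (use R(2,3) adj' in blast)+
  qed (use c D cD m in auto)
  have S1: "S \<inter> V1 = {}" by (rule T.S1_empty)
  have S2: "S \<inter> V2 = {}"
  proof (rule ccontr)
    assume "S \<inter> V2 \<noteq> {}"
    then obtain x where x: "x \<in> S \<inter> V2" by blast
    then have "e1 x \<inter> S = {}" using e1(1)[of x] S1 by blast
    then show False using d2[OF x] c by simp
  qed
  \<comment> \<open>Only the nonpositive contribution of \<open>S \<inter> V3\<close> is
    left.\<close>
  have "\<phi> S \<le> 0" unfolding \<phi>_def arcs_def S1 S2 by simp
  then have le: "\<phi> V \<le> 0" using S(2)[of V] by auto
  have Vi: "V \<inter> V1 = V1" "V \<inter> V2 = V2" "V \<inter> V3 = V3" by (auto simp: V_def)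
  have fe: "finite (e1 x)" "finite (e3 x)" if "x \<in> V2" for x
    using e1(1)[of x] e3(1)[of x] that fin by (auto intro: finite_subset)
  have "e1 v \<inter> V = e1 v" "e3 v \<inter> V = e3 v" if "v \<in> V2" for v
    using e1(1)[OF that] e3(1)[OF that] by (auto simp: V_def)
  then have "card (arcs e1 V2 V) = card V2 * (2 * c + 1)" "card (arcs e3 V2 V) = card V2 * m"
    using fin fe e1(2) e3(2) by (simp_all add: arcs_def Vi card_SigmaI)
  then have "int m * int (card V2) \<le> int m * int A * int (card V1) + 2 * int D * int (card V3)"
    using le by (simp add: \<phi>_def Vi algebra_simps)
  then have "int (m * card V2) \<le> int (m * A * card V1 + 2 * D * card V3)" by simp
  then show ?thesis unfolding A_def by linarith
qed

section \<open>Growth of the levels\<close>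

text \<open>The surplus \<open>k\<^sup>2\<close> in the degree pays for backward edges: a vertex
  either has \<open>m\<close> forward neighbours or more than \<open>k\<^sup>2\<close> backward
  ones. The single vertex on level 0 makes ancestral lines meet.\<close>

locale levelled_graph =
  fixes adj :: "'a \<Rightarrow> 'a \<Rightarrow> bool" and V :: "'a set" and lev :: "'a \<Rightarrow> nat" and par :: "'a \<Rightarrow> 'a"
    and root :: 'a and k m :: nat
  assumes sym: "adj u v \<Longrightarrow> adj v u" and finV: "finite V"
    and adj_in: "adj u v \<Longrightarrow> u \<in> V"
    and adj_lev: "adj u v \<Longrightarrow> lev u = Suc (lev v) \<or> lev v = Suc (lev u)"
    and par: "v \<in> V \<Longrightarrow> 0 < lev v \<Longrightarrow> par v \<in> V \<and> adj v (par v) \<and> Suc (lev (par v)) = lev v"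
    and root_in: "root \<in> V" and root: "v \<in> V \<Longrightarrow> lev v = 0 \<longleftrightarrow> v = root"
    and deg: "v \<in> V \<Longrightarrow> m + k\<^sup>2 \<le> card {u \<in> V. adj v u}"
    and k: "4 \<le> k" and m: "(20 * k) ^ (k + 4) \<le> m"
    and no_cycle: "inj_on f {..<2 * k} \<Longrightarrow> f ` {..<2 * k} \<subseteq> V \<Longrightarrow>
      (\<And>s. s < 2 * k \<Longrightarrow> adj (f s) (f (Suc s mod (2 * k)))) \<Longrightarrow> False"
begin

definition L :: "nat \<Rightarrow> 'a set" where
  "L i = {v \<in> V. lev v = i}"

lemma finite_L [simp]: "finite (L i)" using finV by (simp add: L_def)

lemma L_disjoint: "i \<noteq> j \<Longrightarrow> L i \<inter> L j = {}" by (auto simp: L_def)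

lemma L_0: "L 0 = {root}" using root root_in by (auto simp: L_def)

lemma par_L: "v \<in> L (Suc i) \<Longrightarrow> par v \<in> L i \<and> adj v (par v)"
  using par[of v] by (auto simp: L_def)

text \<open>Edges change the level by one, so the middle level is a colour class of the cycle;
  \<open>Suc i < k\<close> leaves the path to be closed through the tree a positive length.\<close>

lemma no_theta_three_levels:
  assumes i: "Suc i < k" and th: "theta adj k R" and R: "set R \<subseteq> L i \<union> L (Suc i) \<union> L (Suc (Suc i))"
    and wp: "\<And>w. w \<in> set R \<Longrightarrow> w \<in> L (Suc i) \<Longrightarrow> \<exists>u\<in>L i. u \<notin> set R \<and> adj w u"
  shows False
proof -
  have lv: "v \<in> V \<and> (lev v = i \<or> lev v = Suc i \<or> lev v = Suc (Suc i))" if "v \<in> set R" for v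
    using that R by (auto simp: L_def)
  have "\<exists>f. inj_on f {..<2 * k} \<and> f ` {..<2 * k} \<subseteq> V \<and> (\<forall>s<2 * k. adj (f s) (f (Suc s mod (2 * k))))"
  proof (rule cycle_through_ancestors[OF th sym, where lev = lev and i = "Suc i" and par = par])
    show "lev u = Suc i \<longleftrightarrow> lev v \<noteq> Suc i" if "u \<in> set R" "v \<in> set R" "adj u v" for u v
      using lv[OF that(1)] lv[OF that(2)] adj_lev[OF that(3)] by auto
    show "Suc i \<le> Suc (lev v)" if "v \<in> set R" for v
      using lv[OF that] by auto
    show "set R \<subseteq> V" using lv by auto
    show "\<exists>u. u \<in> V \<and> u \<notin> set R \<and> adj v u \<and> Suc (lev u) = Suc i" if "v \<in> set R" "lev v = Suc i" for v
      using wp[OF that(1)] lv[OF that(1)] that(2) by (auto simp: L_def)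
    show "u = v" if "u \<in> V" "v \<in> V" "lev u = 0" "lev v = 0" for u v
      using root that by auto
  qed (use par i in auto)
  then show False using no_cycle by blast
qed

definition links :: "'a set \<Rightarrow> 'a set \<Rightarrow> ('a \<times> 'a) set" where
  "links S T = {(u, v). u \<in> S \<and> v \<in> T \<and> adj u v}"

lemma finite_links [simp]: "finite S \<Longrightarrow> finite T \<Longrightarrow> finite (links S T)"
  by (rule finite_subset[of _ "S \<times> T"]) (auto simp: links_def)

lemma card_links_right:
  assumes "finite S" "finite T"
  shows "card (links S T) = (\<Sum>v\<in>T. card {u \<in> S. adj v u})"
proof -
  have "links S T = prod.swap ` Sigma T (\<lambda>v. {u \<in> S. adj v u})"
    using sym by (force simp: links_def)
  then have "card (links S T) = card (Sigma T (\<lambda>v. {u \<in> S. adj v u}))"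
    by (simp add: card_image)
  then show ?thesis using assms by (simp add: card_SigmaI)
qed

lemma card_links_left:
  assumes "finite S" "finite T"
  shows "card (links S T) = (\<Sum>u\<in>S. card {v \<in> T. adj u v})"
proof -
  have "links S T = Sigma S (\<lambda>u. {v \<in> T. adj u v})" by (auto simp: links_def)
  then show ?thesis using assms by (simp add: card_SigmaI)
qed

text \<open>A cycle with a chord between these levels counts as one with middle level
  \<open>L i\<close>: the parents of its vertices there lie one level earlier, hence off the cycle.
  For \<open>i = 0\<close> the links form a star.\<close>

lemma card_links_le:
  assumes i: "i < k" and S: "S \<subseteq> L i" and T: "T \<subseteq> L (Suc i)"
  shows "card (links S T) \<le> (k - 1) * (card S + card T)"
proof (rule ccontr)
  assume dense: "\<not> ?thesis"
  have fin: "finite S" "finite T" using S T finite_L finite_subset by blast+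
  have disj: "S \<inter> T = {}" using S T L_disjoint[of i "Suc i"] by auto
  show False
  proof (cases i)
    case 0
    have "card (links S T) \<le> card (S \<times> T)"
      using fin by (intro card_mono) (auto simp: links_def)
    also have "\<dots> \<le> 1 * card T"
      unfolding card_cartesian_product using S 0 card_mono[of "{root}" S] L_0 by (intro mult_le_mono1) auto
    also have "\<dots> \<le> (k - 1) * (card S + card T)" using k by (intro mult_le_mono) auto
    finally show False using dense by simp
  next
    case (Suc i')
    have F: "links S T \<subseteq> S \<times> T" by (auto simp: links_def)
    from theta_if_dense[OF fin disj F, of k] dense k obtain R where
      R: "theta (\<lambda>u v. (u, v) \<in> links S T \<or> (v, u) \<in> links S T) k R" "set R \<subseteq> S \<union> T"
      by auto
    have th: "theta adj k R" by (rule theta_mono[OF R(1)]) (use sym in \<open>auto simp: links_def\<close>)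
    show False
    proof (rule no_theta_three_levels[of i', OF _ th])
      show "Suc i' < k" using i Suc by simp
      show "set R \<subseteq> L i' \<union> L (Suc i') \<union> L (Suc (Suc i'))" using R(2) S T Suc by auto
      fix w assume w: "w \<in> set R" "w \<in> L (Suc i')"
      have "par w \<notin> set R"
      proof
        assume "par w \<in> set R"
        then have "par w \<in> L (Suc i') \<union> L (Suc (Suc i'))"
          using R(2) S[unfolded Suc] T[unfolded Suc] by blast
        then show False using par_L[OF w(2)] by (simp add: L_def)
      qed
      then show "\<exists>u\<in>L i'. u \<notin> set R \<and> adj w u" using par_L[OF w(2)] by blast
    qed
  qed
qed

lemma degree_split:
  assumes "v \<in> L (Suc i)"
  shows "m + k\<^sup>2 \<le> card {u \<in> L i. adj v u} + card {u \<in> L (Suc (Suc i)). adj v u}"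
proof -
  have "{u \<in> V. adj v u} \<subseteq> {u \<in> L i. adj v u} \<union> {u \<in> L (Suc (Suc i)). adj v u}"
    using assms adj_lev by (fastforce simp: L_def)
  then have "card {u \<in> V. adj v u} \<le> card ({u \<in> L i. adj v u} \<union> {u \<in> L (Suc (Suc i)). adj v u})"
    by (intro card_mono) auto
  also have "\<dots> \<le> card {u \<in> L i. adj v u} + card {u \<in> L (Suc (Suc i)). adj v u}" by (rule card_Un_le)
  finally show ?thesis using deg[of v] assms by (simp add: L_def)
qed

lemma m_large: "4 * (k * (8 * k) ^ (k + 2) + 2 * k) \<le> m" "24 * k \<le> m" "k\<^sup>2 \<le> m"
proof -
  have "(8 * k) ^ (k + 2) * (400 * k\<^sup>2) \<le> (20 * k) ^ (k + 2) * (400 * k\<^sup>2)"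
    by (intro mult_le_mono1 power_mono) auto
  also have "\<dots> = (20 * k) ^ (k + 2) * (20 * k) ^ 2" by (simp add: power_mult_distrib)
  also have "\<dots> = (20 * k) ^ ((k + 2) + 2)" by (rule power_add[symmetric])
  also have "(k + 2) + 2 = k + 4" by simp
  finally have 1: "(8 * k) ^ (k + 2) * (400 * k\<^sup>2) \<le> m" using m by linarith
  have pos: "1 \<le> (8 * k) ^ (k + 2)" using k by simp
  have kk: "k \<le> k\<^sup>2" by (simp add: power2_eq_square)
  have 2: "400 * k\<^sup>2 \<le> m" using mult_le_mono1[OF pos, of "400 * k\<^sup>2"] 1 by linarith
  then show "24 * k \<le> m" "k\<^sup>2 \<le> m" using kk by auto
  have "2 * k \<le> 2 * k * (8 * k) ^ (k + 2)"
    using mult_le_mono2[OF pos, of "2 * k"] by (simp only: mult_1_right)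
  then have "4 * (k * (8 * k) ^ (k + 2) + 2 * k) \<le> 4 * (k * (8 * k) ^ (k + 2) + 2 * k * (8 * k) ^ (k + 2))"
    by (intro mult_le_mono2 add_left_mono)
  also have "\<dots> = (8 * k) ^ (k + 2) * (12 * k)" by (simp add: algebra_simps)
  also have "\<dots> \<le> (8 * k) ^ (k + 2) * (400 * k\<^sup>2)" using kk by (intro mult_le_mono2) linarith
  finally show "4 * (k * (8 * k) ^ (k + 2) + 2 * k) \<le> m" using 1 by linarith
qed

text \<open>Inductively, \<open>L (Suc i)\<close> sends back at most \<open>2 * (k - 1)\<close>
  edges per vertex on average, less than the surplus \<open>k\<^sup>2\<close>, so \<open>m\<close>
  forward edges per vertex remain. The edge bound for the next two levels turns them into
  growth.\<close>

lemma level_growth: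
  assumes "i < k"
  shows "card (L i) \<le> card (L (Suc i)) \<and> m * card (L i) \<le> card (links (L i) (L (Suc i))) \<and>
    m * card (L i) \<le> k * card (L (Suc i))"
  using assms
proof (induction i)
  case 0
  have c0: "card (L 0) = 1" by (simp add: L_0)
  have "{u \<in> V. adj root u} \<subseteq> {u \<in> L (Suc 0). adj root u}"
    using adj_lev root_in root by (fastforce simp: L_def)
  then have "card {u \<in> V. adj root u} \<le> card {u \<in> L (Suc 0). adj root u}" by (intro card_mono) auto
  then have d: "m + k\<^sup>2 \<le> card {u \<in> L (Suc 0). adj root u}" using deg[OF root_in] by simp
  also have "\<dots> \<le> card (L (Suc 0))" by (intro card_mono) auto
  finally have "m \<le> card (L (Suc 0))" "k\<^sup>2 \<le> card (L (Suc 0))" by auto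
  moreover have "card (links (L 0) (L (Suc 0))) = card {u \<in> L (Suc 0). adj root u}"
    unfolding card_links_left[OF finite_L finite_L] by (simp add: L_0)
  moreover have "card (L (Suc 0)) \<le> k * card (L (Suc 0))" using k by simp
  moreover have "1 \<le> k\<^sup>2" using k by simp
  ultimately show ?case using d unfolding c0 by linarith
next
  case (Suc i)
  let ?a = "card (L i)" and ?b = "card (L (Suc i))" and ?c = "card (L (Suc (Suc i)))"
  let ?e = "card (links (L i) (L (Suc i)))" and ?f = "card (links (L (Suc i)) (L (Suc (Suc i))))"
  have IH: "?a \<le> ?b" using Suc by simp
  have "?b * (m + k\<^sup>2) \<le> (\<Sum>v\<in>L (Suc i). card {u \<in> L i. adj v u} + card {u \<in> L (Suc (Suc i)). adj v u})"
    using sum_bounded_below[of "L (Suc i)" "m + k\<^sup>2" "\<lambda>v. card {u \<in> L i. adj v u} + card {u \<in> L (Suc (Suc i)). adj v u}"]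
      degree_split by simp
  also have "\<dots> = ?e + ?f"
    by (simp add: sum.distrib card_links_right[OF finite_L finite_L, of i] card_links_left[OF finite_L finite_L, of "Suc i"])
  finally have 1: "?b * (m + k\<^sup>2) \<le> ?e + ?f" .
  have "?e \<le> (k - 1) * (?a + ?b)" by (rule card_links_le[where i = i]) (use Suc.prems in auto)
  also have "\<dots> \<le> (k - 1) * (2 * ?b)" using IH by (intro mult_le_mono2) simp
  also have "\<dots> \<le> ?b * k\<^sup>2"
  proof -
    have "(k - 1) * 2 \<le> k\<^sup>2" using k by (simp add: power2_eq_square mult_le_mono)
    from mult_le_mono2[OF this, of ?b] show ?thesis by (simp only: mult_ac)
  qed
  finally have 2: "m * ?b \<le> ?f" using 1 by (simp add: algebra_simps)
  have "?f \<le> (k - 1) * (?b + ?c)" by (rule card_links_le[where i = "Suc i"]) (use Suc.prems in auto)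
  then have 3: "?f \<le> (k - 1) * ?b + (k - 1) * ?c" by (simp only: add_mult_distrib2)
  have "k * k * ?b \<le> m * ?b" using m_large(3) by (intro mult_le_mono1) (simp add: power2_eq_square)
  then have 4: "k * k * ?b \<le> (k - 1) * ?b + (k - 1) * ?c" using 2 3 by linarith
  obtain k' where k': "k = Suc k'" using k by (cases k) auto
  have "?b + k' * ?b + k' * (k' * ?b) \<le> k' * ?c" using 4 by (simp add: k' algebra_simps)
  then have "(k - 1) * ((k - 1) * ?b) \<le> (k - 1) * ?c" unfolding k' diff_Suc_1 by linarith
  then have 5: "(k - 1) * ?b \<le> ?c" using k by simp
  have "1 * ?b \<le> (k - 1) * ?b" using k by (intro mult_le_mono1) simp
  then have 6: "?b \<le> ?c" using 5 by linarith
  have "m * ?b \<le> ?c + (k - 1) * ?c" using 2 3 5 by linarith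
  also have "\<dots> = k * ?c" by (simp add: k')
  finally show ?case using 2 6 by blast
qed

definition back_deg :: "nat \<Rightarrow> 'a \<Rightarrow> nat" where
  "back_deg i v = card {u \<in> L i. adj v u}"

definition forward_rich :: "nat \<Rightarrow> nat \<Rightarrow> 'a set" where
  "forward_rich i t = {v \<in> L (Suc i). t \<le> back_deg i v \<and> m \<le> card {u \<in> L (Suc (Suc i)). adj v u}}"

text \<open>Layer-cake summation of the backward degrees, cut off at \<open>k\<close>. The vertices with fewer than \<open>m\<close>
  forward neighbours have more than \<open>k\<^sup>2\<close> backward ones, hence are few.\<close>

lemma card_links_le_forward_rich:
  assumes i: "Suc i < k"
  shows "card (links (L i) (L (Suc i))) \<le> (\<Sum>t\<in>{1..<k}. card (forward_rich i t)) + 2 * k * card (L i)"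
proof -
  define N where "N t = {v \<in> L (Suc i). t \<le> back_deg i v}" for t
  define B where "B = {v \<in> L (Suc i). card {u \<in> L (Suc (Suc i)). adj v u} < m}"
  define H where "H = N k"
  have fin: "finite (N t)" "finite B" for t by (auto simp: N_def B_def)
  have subs: "B \<subseteq> L (Suc i)" "H \<subseteq> L (Suc i)" by (auto simp: B_def H_def N_def)
  have Bk: "k\<^sup>2 \<le> back_deg i v" if "v \<in> B" for v
    using degree_split[of v i] that by (auto simp: B_def back_deg_def)
  have "card B * k\<^sup>2 \<le> (\<Sum>v\<in>B. back_deg i v)" using sum_bounded_below[of B "k\<^sup>2" "back_deg i"] Bk by simp
  also have "\<dots> = card (links (L i) B)" using card_links_right[OF finite_L fin(2), of i] by (simp add: back_deg_def)
  also have "\<dots> \<le> (k - 1) * (card (L i) + card B)" by (rule card_links_le[where i = i]) (use i subs in auto)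
  finally have 1: "card B * (k * k) \<le> (k - 1) * card (L i) + (k - 1) * card B"
    by (simp add: power2_eq_square algebra_simps)
  obtain k' where k': "k = Suc k'" "3 \<le> k'" using k by (cases k) auto
  have "card B + k' * card B + k' * (k' * card B) \<le> k' * card (L i)"
    using 1 by (simp add: k' algebra_simps)
  then have "k' * (k' * card B) \<le> k' * card (L i)" by linarith
  then have "k' * card B \<le> card (L i)" using k' by simp
  moreover have "1 * card B \<le> k' * card B" using k' by (intro mult_le_mono1) simp
  ultimately have cB: "card B \<le> card (L i)" by linarith
  \<comment> \<open>The cut-off loses little: by the edge bound, the backward degrees in
    \<open>H\<close> exceed \<open>k - 1\<close> by at most \<open>(k - 1) * card (L i)\<close> in
    total.\<close>
  have "(\<Sum>v\<in>H. back_deg i v) = card (links (L i) H)"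
    using card_links_right[OF finite_L, of H i] fin by (simp add: back_deg_def H_def)
  also have "\<dots> \<le> (k - 1) * (card (L i) + card H)" by (rule card_links_le[where i = i]) (use i subs in auto)
  finally have sumH: "(\<Sum>v\<in>H. back_deg i v) \<le> (k - 1) * card (L i) + (k - 1) * card H"
    by (simp add: algebra_simps)
  have cnt: "(\<Sum>t\<in>{1..<k}. if t \<le> b then 1 else 0) = min b (k - 1)" for b
  proof -
    have "(\<Sum>t\<in>{1..<k}. if t \<le> b then 1 else 0) = card {t \<in> {1..<k}. t \<le> b}"
      by (simp only: card_eq_sum sum.inter_filter finite_atLeastLessThan)
    also have "{t \<in> {1..<k}. t \<le> b} = {1..min b (k - 1)}" using k by auto
    finally show ?thesis by simp
  qed
  have "(\<Sum>t\<in>{1..<k}. card (N t)) = (\<Sum>t\<in>{1..<k}. \<Sum>v\<in>L (Suc i). if t \<le> back_deg i v then 1 else 0)"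
    by (simp only: N_def card_eq_sum sum.inter_filter finite_L)
  also have "\<dots> = (\<Sum>v\<in>L (Suc i). \<Sum>t\<in>{1..<k}. if t \<le> back_deg i v then 1 else 0)"
    by (rule sum.swap)
  also have "\<dots> = (\<Sum>v\<in>L (Suc i). min (back_deg i v) (k - 1))"
    by (simp only: cnt)
  also have "\<dots> = (\<Sum>v\<in>L (Suc i) - H. min (back_deg i v) (k - 1)) + (\<Sum>v\<in>H. min (back_deg i v) (k - 1))"
    by (rule sum.subset_diff) (use subs in auto)
  also have "(\<Sum>v\<in>L (Suc i) - H. min (back_deg i v) (k - 1)) = (\<Sum>v\<in>L (Suc i) - H. back_deg i v)"
    by (intro sum.cong) (auto simp: H_def N_def min_def)
  also have "(\<Sum>v\<in>H. min (back_deg i v) (k - 1)) = (\<Sum>v\<in>H. k - 1)"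
    by (intro sum.cong) (auto simp: H_def N_def min_def)
  finally have sumN: "(\<Sum>t\<in>{1..<k}. card (N t)) = (\<Sum>v\<in>L (Suc i) - H. back_deg i v) + (k - 1) * card H"
    by (simp add: mult.commute)
  have "card (links (L i) (L (Suc i))) = (\<Sum>v\<in>L (Suc i). back_deg i v)"
    using card_links_right[OF finite_L finite_L, of i "Suc i"] by (simp add: back_deg_def)
  also have "\<dots> = (\<Sum>v\<in>L (Suc i) - H. back_deg i v) + (\<Sum>v\<in>H. back_deg i v)"
    by (rule sum.subset_diff) (use subs in auto)
  finally have 2: "card (links (L i) (L (Suc i))) \<le> (\<Sum>t\<in>{1..<k}. card (N t)) + (k - 1) * card (L i)"
    using sumN sumH by linarith
  have "card (N t) \<le> card (forward_rich i t) + card B" for t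
  proof -
    have "N t \<subseteq> forward_rich i t \<union> B" by (auto simp: N_def B_def forward_rich_def)
    then have "card (N t) \<le> card (forward_rich i t \<union> B)"
      by (intro card_mono) (auto simp: forward_rich_def fin)
    then show ?thesis using card_Un_le[of "forward_rich i t" B] by linarith
  qed
  then have "(\<Sum>t\<in>{1..<k}. card (N t)) \<le> (\<Sum>t\<in>{1..<k}. card (forward_rich i t) + card B)"
    by (intro sum_mono) auto
  also have "\<dots> = (\<Sum>t\<in>{1..<k}. card (forward_rich i t)) + (k - 1) * card B" by (simp add: sum.distrib)
  also have "\<dots> \<le> (\<Sum>t\<in>{1..<k}. card (forward_rich i t)) + (k - 1) * card (L i)" using cB by simp
  finally have "card (links (L i) (L (Suc i))) \<le> (\<Sum>t\<in>{1..<k}. card (forward_rich i t)) + 2 * ((k - 1) * card (L i))"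
    using 2 by linarith
  also have "2 * ((k - 1) * card (L i)) \<le> 2 * k * card (L i)" by simp
  finally show ?thesis by simp
qed

end

section \<open>Estimates for the logarithm\<close>

lemma sum_inverse_le_ln:
  assumes "7 \<le> n"
  shows "(\<Sum>t\<in>{7..<n}. 1 / (real t - 4)) \<le> ln (real n - 5)"
  using assms
proof (induction n rule: dec_induct)
  case base
  then show ?case by simp
next
  case (step n)
  have n: "7 \<le> real n" using step by simp
  have "ln ((real n - 5) / (real n - 4)) \<le> (real n - 5) / (real n - 4) - 1"
    using n by (intro ln_le_minus_one) simp
  also have "\<dots> = - (1 / (real n - 4))" using n by (simp add: field_simps)
  finally have "1 / (real n - 4) \<le> ln (real n - 4) - ln (real n - 5)"
    using n by (simp add: ln_div)
  then show ?case using step n by (simp add: atLeastLessThanSuc)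
qed

text \<open>The value \<open>4 / 3\<close> is what turns \<open>12 * k\<close> into at most
  \<open>9 * k * ln k\<close>. Since \<open>ln (15 / 14)\<close> is at least \<open>1 / 15\<close>,
  twenty copies give it exactly.\<close>

lemma four_thirds_le_ln_four: "4 / 3 \<le> ln (4 :: real)"
proof -
  have "ln (14 / 15 :: real) \<le> 14 / 15 - 1" by (intro ln_le_minus_one) simp
  moreover have "ln (15 / 14 :: real) = - ln (14 / 15)" by (simp add: ln_div)
  ultimately have "4 / 3 \<le> 20 * ln (15 / 14 :: real)" by simp
  also have "\<dots> = ln ((15 / 14) ^ 20)" by (simp add: ln_realpow)
  also have "\<dots> \<le> ln 4" by (subst ln_le_cancel_iff) (auto simp: power_divide)
  finally show ?thesis .
qed

section \<open>Growth over two levels\<close>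

context levelled_graph
begin

lemma card_forward_rich_small:
  assumes "Suc i < k"
  shows "m * card (forward_rich i t) \<le> k * card (L (Suc (Suc i)))"
proof -
  have "card (forward_rich i t) \<le> card (L (Suc i))"
    by (intro card_mono) (auto simp: forward_rich_def)
  then have "m * card (forward_rich i t) \<le> m * card (L (Suc i))" by simp
  then show ?thesis using level_growth[OF assms] by linarith
qed

text \<open>The condition \<open>2 * c + 1 \<le> t\<close> suggests
  \<open>c = (t - 1) div 2\<close>, and \<open>3 \<le> c\<close> is why \<open>t\<close> starts at
  7. Up to rounding \<open>D\<close> is \<open>(k - 1) / (c - 1)\<close>; the summand 3 covers the
  remainder and ensures \<open>3 \<le> D\<close>.\<close>

lemma card_forward_rich_large:
  assumes i: "Suc i < k" and t: "7 \<le> t" "t < k"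
  shows "m * card (forward_rich i t) \<le> m * (8 * k) ^ (k + 2) * card (L i) +
    2 * ((k - 1) div ((t - 1) div 2 - 1) + 3) * card (L (Suc (Suc i)))"
proof (rule middle_layer_bound[where c = "(t - 1) div 2", OF sym])
  let ?c = "(t - 1) div 2"
  have c: "3 \<le> ?c" using t by simp
  show "3 \<le> ?c" by (rule c)
  have "(k - 1) div (?c - 1) \<le> (k - 1) div 2" using c by (intro div_le_mono2) auto
  then show "(k - 1) div (?c - 1) + 3 \<le> k" using t by linarith
  have "k - 1 = ((k - 1) div (?c - 1)) * (?c - 1) + (k - 1) mod (?c - 1)"
    by (rule div_mult_mod_eq[symmetric])
  also have "\<dots> \<le> ((k - 1) div (?c - 1)) * (?c - 1) + 3 * (?c - 1)"
  proof -
    have "(k - 1) mod (?c - 1) < ?c - 1" using c by (intro mod_less_divisor) simp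
    then show ?thesis by simp
  qed
  also have "\<dots> = (?c - 1) * ((k - 1) div (?c - 1) + 3)" by (simp only: algebra_simps)
  finally show "k - 1 \<le> (?c - 1) * ((k - 1) div (?c - 1) + 3)" .
  show "24 * k \<le> m" by (rule m_large)
  have tc: "2 * ?c + 1 \<le> t" using t by simp
  show "2 * ?c + 1 \<le> card {u \<in> L i. adj v u}" if "v \<in> forward_rich i t" for v
    using that tc by (simp add: forward_rich_def back_deg_def)
  show "m \<le> card {u \<in> L (Suc (Suc i)). adj v u}" if "v \<in> forward_rich i t" for v
    using that by (simp add: forward_rich_def)
  have sub: "forward_rich i t \<subseteq> L (Suc i)" by (auto simp: forward_rich_def)
  show "finite (forward_rich i t)" using sub finite_L finite_subset by blast
  show "L i \<inter> forward_rich i t = {}" "L i \<inter> L (Suc (Suc i)) = {}" "forward_rich i t \<inter> L (Suc (Suc i)) = {}"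
    using sub L_disjoint[of i "Suc i"] L_disjoint[of i "Suc (Suc i)"] L_disjoint[of "Suc i" "Suc (Suc i)"] by auto
  fix R assume R: "theta adj k R" "set R \<subseteq> L i \<union> forward_rich i t \<union> L (Suc (Suc i))"
    "\<And>w. w \<in> set R \<Longrightarrow> w \<in> forward_rich i t \<Longrightarrow> \<exists>u\<in>L i. u \<notin> set R \<and> adj w u"
  show False
  proof (rule no_theta_three_levels[OF i R(1)])
    show "set R \<subseteq> L i \<union> L (Suc i) \<union> L (Suc (Suc i))" using R(2) sub by blast
    fix w assume w: "w \<in> set R" "w \<in> L (Suc i)"
    then have "w \<in> forward_rich i t"
      using R(2) L_disjoint[of i "Suc i"] L_disjoint[of "Suc i" "Suc (Suc i)"] by auto
    then show "\<exists>u\<in>L i. u \<notin> set R \<and> adj w u" using R(3) w(1) by blast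
  qed
qed auto

lemma two_level_growth:
  assumes i: "Suc i < k"
  shows "(real m)\<^sup>2 * real (card (L i)) \<le> 20 * real k * ln (real k) * real (card (L (Suc (Suc i))))"
proof -
  define a where "a = real (card (L i))"
  define z where "z = real (card (L (Suc (Suc i))))"
  define A where "A = real ((8 * k) ^ (k + 2))"
  define h where "h t = 2 * real ((k - 1) div ((t - 1) div 2 - 1) + 3)" for t
  define f where "f t = (if t < 7 then real k * z else real m * A * a + h t * z)" for t
  have az: "0 \<le> a" "0 \<le> z" "0 \<le> A" by (auto simp: a_def z_def A_def)
  have f0: "0 \<le> f t" for t using az by (simp add: f_def h_def)
  have f: "real m * real (card (forward_rich i t)) \<le> f t" if "t < k" for t
  proof (cases "t < 7")
    case True
    then show ?thesis using card_forward_rich_small[OF i, of t]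
      by (simp add: f_def z_def flip: of_nat_mult)
  next
    case False
    have "real (m * card (forward_rich i t)) \<le> real (m * (8 * k) ^ (k + 2) * card (L i) +
        2 * ((k - 1) div ((t - 1) div 2 - 1) + 3) * card (L (Suc (Suc i))))"
      using card_forward_rich_large[OF i _ that] False by (intro of_nat_mono) simp
    then show ?thesis using False by (simp add: f_def z_def a_def A_def h_def)
  qed
  have hb: "h t \<le> 4 * real k * (1 / (real t - 4)) + 6" if t: "7 \<le> t" for t
  proof -
    let ?c = "(t - 1) div 2 - 1"
    have c: "(real t - 4) / 2 \<le> real ?c" "0 < real t - 4"
    proof -
      have "t \<le> 2 * ?c + 4" using t by linarith
      then have "real t \<le> real (2 * ?c + 4)" by (intro of_nat_mono)
      then show "(real t - 4) / 2 \<le> real ?c" by simp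
      show "0 < real t - 4" using t by simp
    qed
    have "real ((k - 1) div ?c) \<le> real (k - 1) / real ?c" by (rule of_nat_div_le_of_nat)
    also have "\<dots> \<le> real k / ((real t - 4) / 2)" using c by (intro frac_le) auto
    finally show ?thesis by (simp add: h_def)
  qed
  have kr: "4 \<le> real k" using k by simp
  have "ln 4 \<le> ln (real k)" using kr by simp
  then have lnk: "4 / 3 \<le> ln (real k)" using four_thirds_le_ln_four by linarith
  have S1: "(\<Sum>t\<in>{7..<k}. h t) \<le> 4 * real k * ln (real k) + 6 * real k"
  proof (cases "7 \<le> k")
    case True
    have "(\<Sum>t\<in>{7..<k}. h t) \<le> (\<Sum>t\<in>{7..<k}. 4 * real k * (1 / (real t - 4)) + 6)"
      by (intro sum_mono hb) simp
    also have "\<dots> = 4 * real k * (\<Sum>t\<in>{7..<k}. 1 / (real t - 4)) + 6 * real (k - 7)"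
      by (simp add: sum.distrib sum_distrib_left)
    also have "\<dots> \<le> 4 * real k * ln (real k - 5) + 6 * real k"
      by (intro add_mono mult_left_mono sum_inverse_le_ln True) auto
    also have "\<dots> \<le> 4 * real k * ln (real k) + 6 * real k"
    proof -
      have "ln (real k - 5) \<le> ln (real k)" using True by (subst ln_le_cancel_iff) auto
      then show ?thesis by (intro add_mono mult_left_mono) auto
    qed
    finally show ?thesis .
  next
    case False
    then show ?thesis using lnk by simp
  qed
  have "real m * a \<le> real (card (links (L i) (L (Suc i))))"
    using level_growth[of i] i unfolding a_def by (simp flip: of_nat_mult)
  also have "\<dots> \<le> (\<Sum>t\<in>{1..<k}. real (card (forward_rich i t))) + 2 * real k * a"
    using of_nat_mono[OF card_links_le_forward_rich[OF i], where 'a = real] by (simp add: a_def)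
  finally have "real m * (real m * a) \<le> real m * ((\<Sum>t\<in>{1..<k}. real (card (forward_rich i t))) + 2 * real k * a)"
    by (intro mult_left_mono) auto
  also have "\<dots> = (\<Sum>t\<in>{1..<k}. real m * real (card (forward_rich i t))) + real m * (2 * real k) * a"
    by (simp add: algebra_simps sum_distrib_left)
  also have "(\<Sum>t\<in>{1..<k}. real m * real (card (forward_rich i t))) \<le> (\<Sum>t\<in>{1..<k}. f t)"
    by (intro sum_mono f) simp
  \<comment> \<open>For \<open>k < 7\<close> this enlarges the range, harmlessly since
    \<open>f\<close> is nonnegative.\<close>
  also have "\<dots> \<le> (\<Sum>t\<in>{1..<7} \<union> {7..<k}. f t)"
    by (intro sum_mono2) (auto simp: f0)
  also have "\<dots> = (\<Sum>t\<in>{1..<7}. f t) + (\<Sum>t\<in>{7..<k}. f t)"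
    by (intro sum.union_disjoint) auto
  also have "(\<Sum>t\<in>{1..<7}. f t) = 6 * real k * z"
    by (simp add: f_def)
  also have "(\<Sum>t\<in>{7..<k}. f t) = real (k - 7) * (real m * A * a) + (\<Sum>t\<in>{7..<k}. h t) * z"
    by (simp add: f_def sum.distrib sum_distrib_right)
  also have "(\<Sum>t\<in>{7..<k}. h t) * z \<le> (4 * real k * ln (real k) + 6 * real k) * z"
    using S1 az by (intro mult_right_mono) auto
  also have "real (k - 7) * (real m * A * a) \<le> real k * (real m * A * a)"
    using az by (intro mult_right_mono) auto
  \<comment> \<open>\<open>12 * k\<close> collects \<open>6 * k\<close> from the six values of
    \<open>t\<close> below 7 and \<open>6 * k\<close> from the constant summand in
    \<open>hb\<close>. The terms with \<open>real m * a\<close> are absorbed next into a quarter of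
    the left side.\<close>
  finally have main: "(real m)\<^sup>2 * a \<le> (12 * real k + 4 * real k * ln (real k)) * z + (real k * A + 2 * real k) * (real m * a)"
    by (simp add: power2_eq_square algebra_simps)
  have "real (4 * (k * (8 * k) ^ (k + 2) + 2 * k)) \<le> real m" using m_large(1) by (rule of_nat_mono)
  then have "real k * A + 2 * real k \<le> real m / 4" by (simp add: A_def)
  then have "(real k * A + 2 * real k) * (real m * a) \<le> real m / 4 * (real m * a)"
    using az by (intro mult_right_mono) auto
  then have "3 / 4 * ((real m)\<^sup>2 * a) \<le> (12 * real k + 4 * real k * ln (real k)) * z"
    using main by (simp add: power2_eq_square)
  also have "\<dots> \<le> (9 * real k * ln (real k) + 4 * real k * ln (real k)) * z"
  proof -
    have "12 * real k \<le> 9 * real k * ln (real k)"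
      using mult_left_mono[of "4 / 3" "ln (real k)" "9 * real k"] lnk by simp
    then show ?thesis using az by (intro mult_right_mono) auto
  qed
  also have "\<dots> = 13 * (real k * ln (real k) * z)" by (simp add: algebra_simps)
  finally have "3 * ((real m)\<^sup>2 * a) \<le> 52 * (real k * ln (real k) * z)" by simp
  moreover have "0 \<le> real k * ln (real k) * z" using lnk az by simp
  \<comment> \<open>\<open>52 / 3\<close> fits below 20, the square of the constant
    \<open>2 * sqrt 5\<close> in the hypothesis on \<open>d\<close>.\<close>
  ultimately have "(real m)\<^sup>2 * a \<le> 20 * (real k * ln (real k) * z)" by linarith
  then show ?thesis by (simp add: a_def z_def mult.assoc)
qed

text \<open>The growth bound advances two levels at a time, so the induction starts at level
  \<open>k mod 2\<close>; level 1 is covered by the degree of the root.\<close>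

lemma last_level_large:
  "real m ^ k \<le> sqrt (20 * real k * ln (real k)) ^ k * real (card (L k))"
proof -
  define s where "s = sqrt (20 * real k * ln (real k))"
  have kr: "4 \<le> real k" using k by simp
  have "ln 4 \<le> ln (real k)" using kr by simp
  then have lnk: "1 < ln (real k)" using four_thirds_le_ln_four by linarith
  have "1 * 1 \<le> (20 * real k) * ln (real k)" using kr lnk by (intro mult_mono) auto
  then have s1: "1 \<le> s" and s2: "s\<^sup>2 = 20 * real k * ln (real k)" by (auto simp: s_def)
  have step: "(real m)\<^sup>2 * real (card (L i)) \<le> s\<^sup>2 * real (card (L (i + 2)))" if "i + 2 \<le> k" for i
    using two_level_growth[of i] that unfolding s2 by simp
  have base: "real m ^ i \<le> s ^ i * real (card (L i))" if "i = 0 \<or> i = 1" for i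
  proof (cases "i = 0")
    case True
    then show ?thesis by (simp add: L_0)
  next
    case False
    have "{u \<in> V. adj root u} \<subseteq> L 1"
      using adj_lev root_in root by (fastforce simp: L_def)
    then have "card {u \<in> V. adj root u} \<le> card (L 1)" by (intro card_mono) auto
    then have "m \<le> card (L 1)" using deg[OF root_in] by linarith
    then have "1 * real m \<le> s * real (card (L 1))" using s1 by (intro mult_mono) auto
    then show ?thesis using False that by simp
  qed
  have "real m ^ (i + 2 * j) \<le> s ^ (i + 2 * j) * real (card (L (i + 2 * j)))"
    if "i = 0 \<or> i = 1" "i + 2 * j \<le> k" for i j
    using that(2)
  proof (induction j)
    case 0
    then show ?case using base[OF that(1)] by simp
  next
    case (Suc j)
    have "real m ^ (i + 2 * Suc j) = (real m)\<^sup>2 * real m ^ (i + 2 * j)"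
      by (simp add: power_add power2_eq_square)
    also have "\<dots> \<le> (real m)\<^sup>2 * (s ^ (i + 2 * j) * real (card (L (i + 2 * j))))"
      using Suc by (intro mult_left_mono) auto
    also have "\<dots> = s ^ (i + 2 * j) * ((real m)\<^sup>2 * real (card (L (i + 2 * j))))" by simp
    also have "\<dots> \<le> s ^ (i + 2 * j) * (s\<^sup>2 * real (card (L (i + 2 * j + 2))))"
      using step[of "i + 2 * j"] Suc.prems s1 by (intro mult_left_mono) auto
    also have "\<dots> = s ^ (i + 2 * Suc j) * real (card (L (i + 2 * Suc j)))"
      by (simp add: power_add power2_eq_square)
    finally show ?case .
  qed
  note this[of "k mod 2" "k div 2"]
  moreover have "k mod 2 + 2 * (k div 2) = k" "k mod 2 = 0 \<or> k mod 2 = 1" by auto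
  ultimately show ?thesis unfolding s_def by simp
qed

end

section \<open>Reduction to levelled bipartite graphs\<close>

text \<open>Moving \<open>v\<close> across a maximum cut exchanges its crossing edges
  \<open>P\<close> with its other edges \<open>Q\<close>, so \<open>Q\<close> is not larger. Edges
  are counted as ordered pairs, hence twice.\<close>

lemma max_cut:
  fixes adj :: "'a \<Rightarrow> 'a \<Rightarrow> bool"
  assumes fin: "finite V" and sym: "\<And>u v. adj u v \<Longrightarrow> adj v u" and irrefl: "\<And>u. \<not> adj u u"
    and adj_in: "\<And>u v. adj u v \<Longrightarrow> u \<in> V"
  obtains X where "\<And>v. v \<in> V \<Longrightarrow> card {u \<in> V. adj v u} \<le> 2 * card {u \<in> V. adj v u \<and> (u \<in> X \<longleftrightarrow> v \<notin> X)}"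
proof -
  define C where "C X = {(u, w). adj u w \<and> (u \<in> X \<longleftrightarrow> w \<notin> X)}" for X
  have finC: "finite (C X)" for X
  proof (rule finite_subset)
    show "C X \<subseteq> V \<times> V" using adj_in sym unfolding C_def by blast
    show "finite (V \<times> V)" using fin by simp
  qed
  have "finite (Pow V)" "Pow V \<noteq> {}" using fin by auto
  then obtain X where X: "X \<in> Pow V" "\<And>Y. Y \<in> Pow V \<Longrightarrow> card (C Y) \<le> card (C X)"
    using finite_has_maximizer[of "Pow V" "\<lambda>Y. card (C Y)"] by blast
  show ?thesis
  proof
    fix v assume v: "v \<in> V"
    define P where "P = {u \<in> V. adj v u \<and> (u \<in> X \<longleftrightarrow> v \<notin> X)}"
    define Q where "Q = {u \<in> V. adj v u \<and> (u \<in> X \<longleftrightarrow> v \<in> X)}"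
    define Y where "Y = (if v \<in> X then X - {v} else insert v X)"
    define R where "R = {(u, w) \<in> C X. u \<noteq> v \<and> w \<noteq> v}"
    have fin': "finite P" "finite Q" "finite R"
      using fin finC by (auto simp: P_def Q_def R_def intro: rev_finite_subset[OF finC])
    have vPQ: "v \<notin> P" "v \<notin> Q" using irrefl by (auto simp: P_def Q_def)
    have split: "card (R \<union> Pair v ` T \<union> (\<lambda>u. (u, v)) ` T) = card R + 2 * card T"
      if "finite T" "v \<notin> T" for T
    proof -
      have "card (R \<union> Pair v ` T \<union> (\<lambda>u. (u, v)) ` T) = card (R \<union> Pair v ` T) + card ((\<lambda>u. (u, v)) ` T)"
        using fin'(3) that by (intro card_Un_disjoint) (auto simp: R_def)
      also have "card (R \<union> Pair v ` T) = card R + card (Pair v ` T)"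
        using fin'(3) that by (intro card_Un_disjoint) (auto simp: R_def)
      finally show ?thesis by (simp add: card_image inj_on_def)
    qed
    have "C X = R \<union> Pair v ` P \<union> (\<lambda>u. (u, v)) ` P"
      unfolding C_def R_def P_def using adj_in sym irrefl by blast
    moreover have "C Y = R \<union> Pair v ` Q \<union> (\<lambda>u. (u, v)) ` Q"
    proof -
      have Y: "u \<in> Y \<longleftrightarrow> (u \<in> X \<longleftrightarrow> u \<noteq> v)" for u by (auto simp: Y_def)
      have "(a, b) \<in> C Y \<longleftrightarrow> (a, b) \<in> R \<union> Pair v ` Q \<union> (\<lambda>u. (u, v)) ` Q" for a b
        using Y[of a] Y[of b] adj_in[of a b] adj_in[of b a] sym[of a b] sym[of b a] irrefl[of v]
        by (cases "a = v"; cases "b = v") (auto simp: C_def R_def Q_def)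
      then show ?thesis by auto
    qed
    moreover have "card (C Y) \<le> card (C X)"
      by (rule X(2)) (use X(1) v in \<open>auto simp: Y_def\<close>)
    ultimately have "card Q \<le> card P" using split fin' vPQ by simp
    moreover have "{u \<in> V. adj v u} = P \<union> Q" by (auto simp: P_def Q_def)
    then have "card {u \<in> V. adj v u} \<le> card P + card Q" by (simp add: card_Un_le)
    ultimately show "card {u \<in> V. adj v u} \<le> 2 * card {u \<in> V. adj v u \<and> (u \<in> X \<longleftrightarrow> v \<notin> X)}"
      by (simp add: P_def)
  qed
qed

text \<open>Levels are distances from \<open>r0\<close> within its component \<open>W\<close>;
  bipartiteness excludes edges inside a level.\<close>

lemma bipartite_cycle_free_bound:
  fixes adj :: "'a \<Rightarrow> 'a \<Rightarrow> bool"
  assumes finV: "finite V" and sym: "\<And>u v. adj u v \<Longrightarrow> adj v u" and adj_in: "\<And>u v. adj u v \<Longrightarrow> u \<in> V"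
    and bip: "\<And>u v. adj u v \<Longrightarrow> u \<in> X \<longleftrightarrow> v \<notin> X" and r0: "r0 \<in> V"
    and deg: "\<And>v. v \<in> V \<Longrightarrow> m + k\<^sup>2 \<le> card {u \<in> V. adj v u}"
    and k: "4 \<le> k" and m: "(20 * k) ^ (k + 4) \<le> m"
    and no_cycle: "\<And>f. inj_on f {..<2 * k} \<Longrightarrow> f ` {..<2 * k} \<subseteq> V \<Longrightarrow>
      (\<And>s. s < 2 * k \<Longrightarrow> adj (f s) (f (Suc s mod (2 * k)))) \<Longrightarrow> False"
  shows "real m ^ k < sqrt (20 * real k * ln (real k)) ^ k * real (card V)"
proof -
  define W where "W = {v. \<exists>n. (adj ^^ n) r0 v}"
  define lev where "lev v = (LEAST n. (adj ^^ n) r0 v)" for v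
  define par where "par v = (SOME u. u \<in> W \<and> adj v u \<and> Suc (lev u) = lev v)" for v
  have lev: "(adj ^^ lev v) r0 v" if "v \<in> W" for v
    using that LeastI_ex[of "\<lambda>n. (adj ^^ n) r0 v"] by (simp add: W_def lev_def)
  have lev_le: "lev v \<le> n" if "(adj ^^ n) r0 v" for v n
    using that by (simp add: lev_def Least_le)
  have W_adj: "v \<in> W \<and> lev v \<le> Suc (lev u)" if "u \<in> W" "adj u v" for u v
  proof -
    have "(adj ^^ Suc (lev u)) r0 v" using lev[OF that(1)] that(2) by auto
    then show ?thesis using lev_le unfolding W_def by blast
  qed
  have parity: "v \<in> X \<longleftrightarrow> (even n \<longleftrightarrow> r0 \<in> X)" if "(adj ^^ n) r0 v" for v n
    using that
  proof (induction n arbitrary: v)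
    case (Suc n)
    then obtain u where "(adj ^^ n) r0 u" "adj u v" by auto
    then show ?case using Suc.IH bip by auto
  qed auto
  have rootW: "r0 \<in> W" unfolding W_def by (auto intro: exI[of _ 0])
  have WV: "W \<subseteq> V"
  proof
    fix v assume "v \<in> W"
    then obtain n where "(adj ^^ n) r0 v" by (auto simp: W_def)
    then show "v \<in> V" using r0 by (cases n) (auto dest: sym adj_in)
  qed
  have lev0: "lev v = 0 \<longleftrightarrow> v = r0" if "v \<in> W" for v
  proof
    show "v = r0" if "lev v = 0" using lev[OF \<open>v \<in> W\<close>] that by simp
    show "lev v = 0" if "v = r0" using lev_le[of 0 v] that by simp
  qed
  have par: "par v \<in> W \<and> adj v (par v) \<and> Suc (lev (par v)) = lev v" if v: "v \<in> W" "0 < lev v" for v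
  proof -
    obtain n where n: "lev v = Suc n" using v(2) gr0_conv_Suc by blast
    then obtain u where u: "(adj ^^ n) r0 u" "adj u v" using lev[OF v(1)] by auto
    have uW: "u \<in> W" using u(1) by (auto simp: W_def)
    have "Suc (lev u) = lev v" using lev_le[OF u(1)] W_adj[OF uW u(2)] n by simp
    then have "\<exists>u. u \<in> W \<and> adj v u \<and> Suc (lev u) = lev v" using uW u(2) sym by blast
    then show ?thesis unfolding par_def by (rule someI_ex)
  qed
  interpret G: levelled_graph "\<lambda>u v. u \<in> W \<and> adj u v" W lev par r0 k m
  proof
    show "v \<in> W \<and> adj v u" if "u \<in> W \<and> adj u v" for u v using that W_adj sym by blast
    show "finite W" using WV finV finite_subset by blast
    show "lev u = Suc (lev v) \<or> lev v = Suc (lev u)" if a: "u \<in> W \<and> adj u v" for u v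
    proof -
      have v: "v \<in> W" "lev v \<le> Suc (lev u)" using W_adj a by auto
      have "lev u \<le> Suc (lev v)" using W_adj[OF v(1), of u] a sym by blast
      moreover have "lev u \<noteq> lev v"
        using parity[OF lev[OF v(1)]] parity[OF lev, of u] bip[of u v] a by auto
      ultimately show ?thesis using v(2) by linarith
    qed
    show "m + k\<^sup>2 \<le> card {u \<in> W. v \<in> W \<and> adj v u}" if v: "v \<in> W" for v
    proof -
      have "{u \<in> W. v \<in> W \<and> adj v u} = {u \<in> V. adj v u}" using v W_adj WV by blast
      then show ?thesis using deg[of v] v WV by auto
    qed
    show False if "inj_on f {..<2 * k}" "f ` {..<2 * k} \<subseteq> W"
      "\<And>s. s < 2 * k \<Longrightarrow> f s \<in> W \<and> adj (f s) (f (Suc s mod (2 * k)))" for f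
      using no_cycle[of f] that WV by blast
  qed (use par rootW lev0 k m in auto)
  \<comment> \<open>The root is not on level \<open>k\<close>. This makes the bound strict, as
    needed against the weak inequality that the hypothesis on \<open>d\<close> provides.\<close>
  have "card (insert r0 (G.L k)) \<le> card V"
    using finV WV rootW by (intro card_mono) (auto simp: G.L_def)
  moreover have "r0 \<notin> G.L k" using lev0[OF rootW] k by (auto simp: G.L_def)
  ultimately have lt: "card (G.L k) < card V" by simp
  have "1 < ln (real k)"
  proof -
    have "ln 4 \<le> ln (real k)" using k by simp
    then show ?thesis using four_thirds_le_ln_four by linarith
  qed
  then have "0 < sqrt (20 * real k * ln (real k)) ^ k" using k by simp
  then have "sqrt (20 * real k * ln (real k)) ^ k * real (card (G.L k))
      < sqrt (20 * real k * ln (real k)) ^ k * real (card V)"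
    using lt by (intro mult_strict_left_mono) auto
  then show ?thesis using G.last_level_large by linarith
qed

section \<open>From sets of edges to adjacency, and the conclusion\<close>

lemma card_nbrs_eq_vdegree:
  assumes "simple_graph V E"
  shows "card {u \<in> V. {v, u} \<in> E} = vdegree E v"
proof -
  have "{e \<in> E. v \<in> e} = (\<lambda>u. {v, u}) ` {u \<in> V. {v, u} \<in> E}"
  proof (intro equalityI subsetI)
    fix e assume e: "e \<in> {e \<in> E. v \<in> e}"
    then have "e \<subseteq> V" "card e = 2" using assms by (auto simp: simple_graph_def)
    then obtain a b where "e = {a, b}" by (auto simp: card_2_iff)
    then obtain u where "e = {v, u}" using e by auto
    then show "e \<in> (\<lambda>u. {v, u}) ` {u \<in> V. {v, u} \<in> E}" using e \<open>e \<subseteq> V\<close> by auto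
  qed auto
  moreover have "inj_on (\<lambda>u. {v, u}) {u \<in> V. {v, u} \<in> E}"
    by (auto simp: inj_on_def doubleton_eq_iff)
  ultimately show ?thesis by (simp add: vdegree_def card_image)
qed

theorem theorem2:
  fixes k n :: nat and d \<Delta> :: real and V :: "'a set" and E :: "'a set set"
  assumes "k \<ge> 4"
    and "\<Delta> = sqrt (real k) * (20 * real k) ^ (2 * k)"
    and "d \<ge> max (2 * sqrt 5 * sqrt (real k * ln (real k)) * real n powr (1 / real k))
                  ((20 * real k) ^ (4 * k\<^sup>2 + 2 * k))"
    and "simple_graph V E" and "V \<noteq> {}" and "card V = n"
    and "real (min_degree V E) \<ge> 2 * d + 5 * (real k)\<^sup>2"
    and "real (max_degree V E) \<le> \<Delta> * d"
  shows "contains_copy V E {..<2 * k} (cycle_edges (2 * k))"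
proof (rule ccontr)
  assume no_copy: "\<not> ?thesis"
  have finV: "finite V" using \<open>simple_graph V E\<close> by (simp add: simple_graph_def)
  define m where "m = nat \<lceil>d\<rceil>"
  define g where "g u v \<longleftrightarrow> {u, v} \<in> E" for u v
  have g_sym: "g v u" if "g u v" for u v using that by (simp add: g_def insert_commute)
  have g_in: "u \<in> V" if "g u v" for u v using that \<open>simple_graph V E\<close> by (auto simp: g_def simple_graph_def)
  have g_irrefl: "\<not> g u u" for u using \<open>simple_graph V E\<close> by (force simp: g_def simple_graph_def)
  obtain X where X: "\<And>v. v \<in> V \<Longrightarrow> card {u \<in> V. g v u} \<le> 2 * card {u \<in> V. g v u \<and> (u \<in> X \<longleftrightarrow> v \<notin> X)}"
    by (rule max_cut[of V g]) (use finV g_sym g_irrefl g_in in blast)+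
  define h where "h u v \<longleftrightarrow> g u v \<and> (v \<in> X \<longleftrightarrow> u \<notin> X)" for u v
  obtain r0 where r0: "r0 \<in> V" using \<open>V \<noteq> {}\<close> by blast
  have kr: "4 \<le> real k" using \<open>k \<ge> 4\<close> by simp
  have d1: "2 * sqrt 5 * sqrt (real k * ln (real k)) * real n powr (1 / real k) \<le> d"
    and d2: "(20 * real k) ^ (4 * k\<^sup>2 + 2 * k) \<le> d"
    using assms(3) by auto
  have "0 \<le> (20 * real k) ^ (4 * k\<^sup>2 + 2 * k)" by simp
  then have d0: "0 \<le> d" using d2 by linarith
  then have md: "d \<le> real m" "real m < d + 1" unfolding m_def by linarith+
  have "real ((20 * k) ^ (k + 4)) \<le> (20 * real k) ^ (4 * k\<^sup>2 + 2 * k)"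
  proof -
    have "k + 4 \<le> 4 * k\<^sup>2 + 2 * k" using \<open>k \<ge> 4\<close> by (simp add: power2_eq_square)
    then have "(20 * real k) ^ (k + 4) \<le> (20 * real k) ^ (4 * k\<^sup>2 + 2 * k)"
      using kr by (intro power_increasing) auto
    then show ?thesis by simp
  qed
  then have m_large: "(20 * k) ^ (k + 4) \<le> m" using d2 md(1) by (simp only: of_nat_le_iff[where 'a = real, symmetric])
  have deg: "m + k\<^sup>2 \<le> card {u \<in> V. h v u}" if v: "v \<in> V" for v
  proof -
    have "min_degree V E \<le> vdegree E v" unfolding min_degree_def using finV v by simp
    also have "\<dots> = card {u \<in> V. g v u}"
      using card_nbrs_eq_vdegree[OF \<open>simple_graph V E\<close>] by (simp add: g_def)
    also have "\<dots> \<le> 2 * card {u \<in> V. h v u}"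
      using X[OF v] unfolding h_def .
    finally have "real (min_degree V E) \<le> 2 * real (card {u \<in> V. h v u})" by linarith
    then have "2 * d + 5 * (real k)\<^sup>2 \<le> 2 * real (card {u \<in> V. h v u})" using assms(7) by linarith
    \<comment> \<open>Halving leaves \<open>d + 5 / 2 * k\<^sup>2\<close>; the excess over
      \<open>k\<^sup>2\<close> pays for rounding \<open>d\<close> up to \<open>m\<close>.\<close>
    moreover have "1 * 1 \<le> real k * real k" using kr by (intro mult_mono) auto
    ultimately have "real m + (real k)\<^sup>2 \<le> real (card {u \<in> V. h v u})"
      using md(2) by (simp add: power2_eq_square)
    then show ?thesis by (simp flip: of_nat_power of_nat_add)
  qed
  have bound: "real m ^ k < sqrt (20 * real k * ln (real k)) ^ k * real (card V)"
  proof (rule bipartite_cycle_free_bound[where adj = h and X = X, OF finV _ _ _ r0 deg \<open>k \<ge> 4\<close> m_large])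
    show "h v u" if "h u v" for u v using that g_sym by (auto simp: h_def)
    show "u \<in> V" if "h u v" for u v using that g_in by (auto simp: h_def)
    show "u \<in> X \<longleftrightarrow> v \<notin> X" if "h u v" for u v using that by (auto simp: h_def)
    fix f assume f: "inj_on f {..<2 * k}" "f ` {..<2 * k} \<subseteq> V"
      "\<And>s. s < 2 * k \<Longrightarrow> h (f s) (f (Suc s mod (2 * k)))"
    have "contains_copy V E {..<2 * k} (cycle_edges (2 * k))"
      unfolding contains_copy_def
    proof (intro exI[of _ f] conjI ballI)
      fix e assume "e \<in> cycle_edges (2 * k)"
      then obtain i where "e = {i, Suc i mod (2 * k)}" "i < 2 * k" by (auto simp: cycle_edges_def)
      then show "f ` e \<in> E" using f(3)[of i] by (simp add: h_def g_def)
    qed (use f in auto)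
    then show False using no_copy by contradiction
  qed
  have lnk: "0 \<le> ln (real k)" using kr by simp
  have n0: "0 < n" using r0 finV \<open>card V = n\<close> card_gt_0_iff by blast
  have "sqrt (20 * real k * ln (real k)) = 2 * sqrt 5 * sqrt (real k * ln (real k))"
  proof -
    have "20 * real k * ln (real k) = 2\<^sup>2 * 5 * (real k * ln (real k))" by simp
    then show ?thesis by (simp only: real_sqrt_mult real_sqrt_abs)
  qed
  then have "sqrt (20 * real k * ln (real k)) * real n powr (1 / real k) \<le> real m"
    using d1 md(1) by simp
  then have "(sqrt (20 * real k * ln (real k)) * real n powr (1 / real k)) ^ k \<le> real m ^ k"
    using lnk by (intro power_mono) auto
  moreover have "(real n powr (1 / real k)) ^ k = real n"
    using n0 kr by (simp add: powr_powr flip: powr_realpow)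
  ultimately show False
    using bound \<open>card V = n\<close> by (simp add: power_mult_distrib)
qed

end
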